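(* Let $P_n(z)=\sum_{k=0}^{n}\xi_k z^k$, where $\xi_0,\xi_1,\ldots$ are iid standard complex Gaussian random variables, and let $\mu$ denote the uniform probability measure on the unit circle of $\mathbb{C}$ (which is the limit in probability of the empirical root measure of $P_n$). For any fixed $t\in(0,1)$, the empirical root distribution of the $\lceil tn\rceil$-th derivative of the polynomial $x\mapsto P_n((1-t)^2x)$ converges weakly in probability, as $n\to\infty$, to $\mathrm{sq}\big((\mathrm{sq}^{-1}\mu)^{\oplus 1/(1-t)}\big)$.
   Context: The empirical root distribution of a polynomial of degree $d$ with roots $x_1,\dots,x_d$ (with multiplicity) is $\frac1d\sum_i\delta_{x_i}$. For a rotationally invariant measure $\nu$ on $\mathbb{C}$, $\mathrm{sq}\,\nu$ is the measure with $(\mathrm{sq}\,\nu)(\mathbb{D}_r)=\nu(\mathbb{D}_{\sqrt r})$ for $r>0$, where $\mathbb{D}_r=\{z:|z|<r\}$; its inverse is $(\mathrm{sq}^{-1}\nu)(\mathbb{D}_r)=\nu(\mathbb{D}_{r^2})$. Free probability setting: $(\mathscr{M},\tau)$ is a von Neumann algebra with a faithful normal tracial state. An element $u$ is a Haar unitary if $u^*u=uu^*=1$ and $\tau(u^n)=0$ for all $n\ge1$. An element $a$ is $R$-diagonal if it has the same $*$-distribution as $uh$ with $u$ Haar unitary, $h\ge0$, and $u,h$ $*$-free. The Brown measure $\mu_a$ of $a$ is $\frac{1}{2\pi}\nabla^2_\lambda \log\Delta(a-\lambda1)$ (distributional Laplacian), $\Delta$ the Fuglede–Kadison determinant. For a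 probability measure $\nu$ on $[0,\infty)$ other than $\delta_0$, let $M_\nu(z)=\int \frac{zt}{1-zt}d\nu(t)$ and define the $S$-transform $\mathscr{S}_\nu(z)=\frac{1+z}{z}M_\nu^{\langle-1\rangle}(z)$ near $0$ (inverse under composition), analytically continued to $(-1+\nu(\{0\}),0)$; for positive $b$ write $\mathscr{S}_b=\mathscr{S}_{\mu_b}$. For an $R$-diagonal $a$ and real $k>1$ put $\mathscr{S}_k(z)=\frac{1+z/k}{k(1+z)}\mathscr{S}_{aa^*}(z/k)$ and $\lambda_2=(\int x^2d\mu_{|a|}(x))^{1/2}$; then $\mu_a^{\oplus k}$ is the radially symmetric probability measure with $\mu_a^{\oplus k}(\overline{\mathbb{D}_r})=1+\mathscr{S}_k^{\langle-1\rangle}(r^{-2})$ for $0<r<\sqrt k\lambda_2$ and $=1$ for $r\ge\sqrt k\lambda_2$. Here $\mathrm{sq}^{-1}\mu=\mu$ is the Brown measure of a Haar unitary, and $(\mathrm{sq}^{-1}\mu)^{\oplus k}$ is defined by taking $a$ to be a Haar unitary. *)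

theory Defs
  imports "HOL-Probability.Probability" "HOL-Computational_Algebra.Polynomial"
    "HOL-Computational_Algebra.Fundamental_Theorem_Algebra"
begin

definition std_complex_gaussian :: "complex measure" where
  "std_complex_gaussian = density lborel (\<lambda>z. ennreal (exp (- (cmod z)\<^sup>2) / pi))"

definition rand_poly :: "(nat \<Rightarrow> 'a \<Rightarrow> complex) \<Rightarrow> nat \<Rightarrow> 'a \<Rightarrow> complex poly" where
  "rand_poly \<xi> n \<omega> = (\<Sum>k\<le>n. monom (\<xi> k \<omega>) k)"

text \<open>Empirical root distribution (1/d) sum_i delta_{x_i}, roots counted with multiplicity.
  (For constant polynomials the value is irrelevant/unspecified.)\<close>
definition empirical_root_measure :: "complex poly \<Rightarrow> complex measure" where
  "empirical_root_measure p = measure_pmf (pmf_of_multiset (proots p))"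

definition weak_conv_in_prob ::
  "'a measure \<Rightarrow> (nat \<Rightarrow> 'a \<Rightarrow> complex measure) \<Rightarrow> complex measure \<Rightarrow> bool" where
  "weak_conv_in_prob M \<nu>s \<nu> \<longleftrightarrow>
     (\<forall>f :: complex \<Rightarrow> real. continuous_on UNIV f \<and> bounded (range f) \<longrightarrow>
       (\<forall>\<epsilon>>0. \<forall>\<delta>>0. \<forall>\<^sub>F n in sequentially.
          \<exists>A \<in> sets M. {\<omega> \<in> space M. \<bar>(\<integral>z. f z \<partial>(\<nu>s n \<omega>)) - (\<integral>z. f z \<partial>\<nu>)\<bar> > \<epsilon>} \<subseteq> A
                       \<and> measure M A < \<delta>))"

definition rot_invariant :: "complex measure \<Rightarrow> bool" where
  "rot_invariant \<nu> \<longleftrightarrow> (\<forall>c. cmod c = 1 \<longrightarrow> distr \<nu> borel (\<lambda>z. c * z) = \<nu>)"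

definition radial_prob :: "complex measure \<Rightarrow> bool" where
  "radial_prob \<nu> \<longleftrightarrow> sets \<nu> = sets borel \<and> prob_space \<nu> \<and> rot_invariant \<nu>"

definition unif_circle :: "complex measure" where
  "unif_circle = distr (uniform_measure lborel {0..2*pi}) borel cis"

definition sq :: "complex measure \<Rightarrow> complex measure" where
  "sq \<nu> = (THE \<mu>. radial_prob \<mu> \<and>
            (\<forall>r>0. measure \<mu> (ball 0 r) = measure \<nu> (ball 0 (sqrt r))))"

definition sq_inv :: "complex measure \<Rightarrow> complex measure" where
  "sq_inv \<nu> = (THE \<mu>. radial_prob \<mu> \<and>
            (\<forall>r>0. measure \<mu> (ball 0 r) = measure \<nu> (ball 0 (r\<^sup>2))))"

definition M_transform :: "real measure \<Rightarrow> real \<Rightarrow> real" where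
  "M_transform \<nu> z = (\<integral>t. z * t / (1 - z * t) \<partial>\<nu>)"

text \<open>S-transform on (-1 + nu{0}, 0): M_nu restricted to the negative reals is strictly increasing
  with range (-1 + nu{0}, 0), and its inverse there is the analytic continuation of the
  compositional inverse near 0.\<close>
definition S_transform :: "real measure \<Rightarrow> real \<Rightarrow> real" where
  "S_transform \<nu> z = (1 + z) / z * (THE y. y < 0 \<and> M_transform \<nu> y = z)"

definition S_k :: "real measure \<Rightarrow> real \<Rightarrow> real \<Rightarrow> real" where
  "S_k \<nu>aa k z = (1 + z / k) / (k * (1 + z)) * S_transform \<nu>aa (z / k)"

text \<open>mu_a^{oplus k}(closed disk r) = 1 + S_k^{<-1>}(r^{-2}) for 0 < r < sqrt k * lambda_2, and 1 beyond;
  the inverse of S_k is taken on (-1,0) (so that the value lies in [0,1]).\<close>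
definition oplus_cdf :: "real measure \<Rightarrow> real \<Rightarrow> real \<Rightarrow> real \<Rightarrow> real" where
  "oplus_cdf \<nu>aa lam2 k r =
     (if r < sqrt k * lam2 then 1 + (THE z. -1 < z \<and> z < 0 \<and> S_k \<nu>aa k z = 1 / r\<^sup>2) else 1)"

text \<open>mu_a^{oplus k}, for an R-diagonal a with law nu_aa of aa* and law nu_abs of |a|.\<close>
definition Rdiag_oplus :: "real measure \<Rightarrow> real measure \<Rightarrow> real \<Rightarrow> complex measure" where
  "Rdiag_oplus \<nu>aa \<nu>abs k =
     (THE \<mu>. radial_prob \<mu> \<and>
        (\<forall>r>0. measure \<mu> (cball 0 r) =
                oplus_cdf \<nu>aa (sqrt (\<integral>x. x\<^sup>2 \<partial>\<nu>abs)) k r))"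

text \<open>(sq^{-1} mu)^{oplus k} with a a Haar unitary: then aa* = 1 and |a| = 1, so both the
  distribution of aa* and the distribution of |a| are the Dirac mass at 1.\<close>
definition haar_oplus :: "real \<Rightarrow> complex measure" where
  "haar_oplus k = Rdiag_oplus (return borel 1) (return borel 1) k"

end

theory Submission
  imports Defs "HOL-Complex_Analysis.Cauchy_Integral_Formula" "HOL-Real_Asymp.Real_Asymp"
begin

text \<open>
  The derivative is a random polynomial \<open>Q(z) = \<Sum>j\<le>N. w\<^sub>j \<xi>\<^sub>j z\<^sup>j\<close> whose weights have increasing ratios
  \<open>\<rho>\<^sub>j = w\<^sub>j\<^sub>-\<^sub>1 / w\<^sub>j\<close>, so \<open>max\<^sub>j w\<^sub>j r\<^sup>j = w\<^sub>N \<Prod>j\<le>N. max r \<rho>\<^sub>j\<close>. For fixed \<open>z\<close>, \<open>ln \<bar>Q(z)\<bar>\<close> differs from the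
  logarithm of this maximal term by \<open>O(ln N)\<close> in \<open>L\<^sup>1\<close>: the coefficient attaining the maximum has a
  bounded density and is independent of the others. Dividing by \<open>N\<close>, the logarithmic potential of the
  empirical root measure converges to \<open>\<integral> ln (max \<bar>z\<bar> (\<rho> x)) dx\<close>, the potential of the radial law with
  quantile function \<open>\<rho> = lim \<rho>\<^sub>j\<close>. Every continuous function of compact support is a uniform limit of
  logarithmic potentials of bounded functions \<open>\<psi>\<close> of compact support and mean zero, so integrating the
  convergence of potentials against \<open>\<psi>\<close> gives vague convergence in probability; the limit being a
  probability measure, no mass escapes. Inverting the explicit \<open>S\<close>-transform identifies the limit.
\<close>

section \<open>Circle averages and integrability of the logarithm\<close>

text \<open>Mean zero is what makes the comparison possible: it annihilates both the leading
  coefficient of the random polynomial and the constant \<open>ln w\<^sub>N\<close>. The latter is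
  of order \<open>n ln n\<close>, hence unbounded after division by the degree. Integrating the
  potentials against \<psi> replaces any control of the roots by Tonelli: the expectation is taken
  at a fixed point z, where the polynomial is a linear combination of independent Gaussians, and the
  resulting bound is the same for all z \<noteq> 0. The textbook representation of a test function
  as the potential of its Laplacian requires smoothness. A difference of two circle means acts as a
  discrete Laplacian: it is built by integration alone, and its potential comes close to a function
  that is merely continuous. The rescaling by \<open>(1 - t)\<^sup>2\<close> is fitted to the free
  side: with k = 1 / (1 - t) the equation for the distribution function of the power is fractional
  linear, and with this factor its solution, as a function of the squared radius, is the inverse of
  the limiting ratio.\<close>

abbreviation unif01 :: "real measure" where
  "unif01 \<equiv> uniform_measure lborel {0..1}"

abbreviation ecis :: "real \<Rightarrow> complex" where
  "ecis x \<equiv> cis (2 * pi * x)"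

lemma prob_space_unif01: "prob_space unif01"
  by (rule prob_space_uniform_measure) auto

interpretation unif01: prob_space unif01
  by (rule prob_space_unif01)

lemma unif01_eq_density: "unif01 = density lborel (indicator {0..1})"
  unfolding uniform_measure_def by (intro density_cong) (auto simp: divide_ennreal_def)

lemma sets_unif01 [measurable_cong]: "sets unif01 = sets borel"
  by simp

lemma nn_integral_unif01:
  assumes [measurable]: "f \<in> borel_measurable borel"
  shows "(\<integral>\<^sup>+x. f x \<partial>unif01) = (\<integral>\<^sup>+x. f x * indicator {0..1} x \<partial>lborel)"
  unfolding unif01_eq_density by (subst nn_integral_density) (auto simp: mult.commute)

lemma AE_unif01_neq: "AE x in unif01. x \<noteq> c"
  by (rule AE_uniform_measureI) (use AE_lborel_singleton[of c] in auto)

text \<open>Contour integrals are gauge integrals over the parameter interval; this carries their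
  values over to \<open>unif01\<close>, where Fubini is available.\<close>

lemma has_integral_imp_unif01:
  fixes f :: "real \<Rightarrow> real"
  assumes "continuous_on {0..1} f" "(f has_integral I) {0..1}" "f \<in> borel_measurable borel"
  shows "integrable unif01 f" "(\<integral>x. f x \<partial>unif01) = I"
proof -
  have *: "set_integrable lborel {0..1} f"
    using assms(1) by (rule borel_integrable_atLeastAtMost')
  have **: "unif01 = density lborel (\<lambda>x. ennreal (indicator {0..1} x))"
    by (simp add: unif01_eq_density ennreal_indicator)
  show "integrable unif01 f"
    using * assms(3) unfolding ** set_integrable_def
    by (subst integrable_density) auto
  have "(\<integral>x. f x \<partial>unif01) = (LINT x:{0..1}|lborel. f x)"
    using assms(3) unfolding ** set_lebesgue_integral_def
    by (subst integral_density) auto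
  also have "\<dots> = integral {0..1} f"
    using * by (rule set_borel_integral_eq_integral)
  finally show "(\<integral>x. f x \<partial>unif01) = I"
    using assms(2) by (simp add: integral_unique)
qed

text \<open>On the closed unit disk 1 + w z stays off the negative real axis, so
  \<open>Ln (1 + w * z)\<close> is holomorphic there. Cauchy's formula at the centre gives the mean
  value \<open>Ln 1 = 0\<close>; the claim is its real part.\<close>

lemma ln_cmod_has_integral_inside:
  assumes "cmod w < 1"
  shows "((\<lambda>x. ln (cmod (1 + w * ecis x))) has_integral 0) {0..1}"
proof -
  define f where "f = (\<lambda>z. Ln (1 + w * z))"
  have nz: "1 + w * z \<notin> \<real>\<^sub>\<le>\<^sub>0" if "z \<in> cball 0 1" for z
  proof
    assume "1 + w * z \<in> \<real>\<^sub>\<le>\<^sub>0"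
    hence "Re (w * z) \<le> -1" by (auto simp: complex_nonpos_Reals_iff)
    moreover have "\<bar>Re (w * z)\<bar> \<le> cmod (w * z)" by (rule abs_Re_le_cmod)
    moreover have "cmod (w * z) \<le> cmod w * 1"
      unfolding norm_mult using that by (intro mult_left_mono) auto
    ultimately show False using assms by linarith
  qed
  have "f holomorphic_on cball 0 1"
    unfolding f_def using nz by (intro holomorphic_intros) auto
  hence "((\<lambda>u. f u / (u - 0)) has_contour_integral (2 * of_real pi * \<i> * f 0)) (circlepath 0 1)"
    by (rule Cauchy_integral_circlepath_simple) auto
  hence "((\<lambda>x. f (circlepath 0 1 x) / (circlepath 0 1 x) *
            vector_derivative (circlepath 0 1) (at x within {0..1})) has_integral 0) {0..1}"
    by (simp add: has_contour_integral_def f_def)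
  hence "((\<lambda>x. f (ecis x) * (2 * of_real pi * \<i>)) has_integral 0) {0..1}"
    by (rule has_integral_eq[rotated], subst vector_derivative_circlepath01)
       (auto simp: circlepath cis_conv_exp mult_ac)
  from has_integral_mult_left[OF this, of "inverse (2 * of_real pi * \<i>)"]
  have "((\<lambda>x. f (ecis x)) has_integral 0) {0..1}"
    by (simp add: field_simps)
  from has_integral_linear[OF this bounded_linear_Re]
  have "((\<lambda>x. Re (f (ecis x))) has_integral 0) {0..1}"
    by (simp add: o_def)
  thus ?thesis
  proof (rule has_integral_eq[rotated])
    fix x :: real assume "x \<in> {0..1}"
    have "1 + w * ecis x \<noteq> 0" using nz[of "ecis x"] by auto
    thus "Re (f (ecis x)) = ln (cmod (1 + w * ecis x))"
      by (simp add: f_def)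
  qed
qed

text \<open>Dividing by the larger of r and \<open>cmod a\<close> leaves 1 + w e with
  \<open>cmod w < 1\<close>, whose logarithm averages to zero. The equality case, where the circle
  passes through a zero, is excluded here and is met later only on null sets.\<close>

lemma circle_average_ln:
  assumes "0 \<le> r" "cmod a \<noteq> r"
  shows "integrable unif01 (\<lambda>x. ln (cmod (a + of_real r * ecis x)))" (is ?A)
    and "(\<integral>x. ln (cmod (a + of_real r * ecis x)) \<partial>unif01) = ln (max r (cmod a))" (is ?B)
proof -
  have pos: "max r (cmod a) > 0" using assms norm_ge_zero[of a] by linarith
  obtain w where w: "cmod w < 1"
    and eq: "\<And>x. cmod (a + of_real r * ecis x) = max r (cmod a) * cmod (1 + w * ecis x)"
  proof (cases "r < cmod a")
    case True
    hence a: "a \<noteq> 0" using assms by auto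
    show ?thesis
    proof (rule that[of "of_real r / a"])
      show "cmod (of_real r / a) < 1" using True assms by (simp add: norm_divide divide_simps)
      fix x
      have "a + of_real r * ecis x = a * (1 + of_real r / a * ecis x)" using a by (simp add: field_simps)
      thus "cmod (a + of_real r * ecis x) = max r (cmod a) * cmod (1 + of_real r / a * ecis x)"
        using True by (simp add: norm_mult)
    qed
  next
    case False
    hence r: "r > cmod a" using assms by auto
    hence r0: "r > 0" using norm_ge_zero[of a] by linarith
    show ?thesis
    \<comment> \<open>For a unit number e,
      \<open>\<bar>a + r e\<bar> = r \<bar>1 + (a / r) / e\<bar>\<close>; conjugation turns the
      inverse of e back into e, and a into its conjugate.\<close>
    proof (rule that[of "cnj a / of_real r"])
      show "cmod (cnj a / of_real r) < 1" using r r0 by (simp add: norm_divide)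
      fix x
      have "a + of_real r * ecis x = of_real r * ecis x * cnj (1 + cnj a / of_real r * ecis x)"
        using r0 by (simp add: field_simps cis_cnj flip: cis_mult)
           (simp add: cis_mult)
      thus "cmod (a + of_real r * ecis x) = max r (cmod a) * cmod (1 + cnj a / of_real r * ecis x)"
        using r r0 by (simp only: norm_mult complex_mod_cnj norm_cis norm_of_real max_def) simp
    qed
  qed
  have nz: "1 + w * ecis x \<noteq> 0" for x
  proof
    assume "1 + w * ecis x = 0"
    hence "w * ecis x = -1" by (simp add: add_eq_0_iff)
    hence "cmod (w * ecis x) = 1" by simp
    with w show False by (simp add: norm_mult)
  qed
  have ln_eq: "ln (cmod (a + of_real r * ecis x)) = ln (max r (cmod a)) + ln (cmod (1 + w * ecis x))" for x
    unfolding eq using pos nz by (subst ln_mult) auto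
  have cont: "continuous_on {0..1} (\<lambda>x. ln (cmod (1 + w * ecis x)))"
    using nz by (intro continuous_intros) auto
  note * = has_integral_imp_unif01[OF cont ln_cmod_has_integral_inside[OF w]]
  have meas: "(\<lambda>x. ln (cmod (1 + w * ecis x))) \<in> borel_measurable borel"
    using nz by (intro borel_measurable_continuous_onI continuous_intros) auto
  show ?A unfolding ln_eq using *[OF meas] by (intro Bochner_Integration.integrable_add) auto
  show ?B unfolding ln_eq using *[OF meas] by (subst Bochner_Integration.integral_add) (auto simp: unif01.prob_space)
qed

section \<open>Integrability of the logarithmic singularity\<close>

lemma abs_ln_le_powr:
  assumes "0 < x" "x \<le> (1::real)"
  shows "\<bar>ln x\<bar> \<le> 2 * x powr (-1/2)"
proof -
  \<comment> \<open>The inequality \<open>ln y \<le> y - 1\<close> at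
    \<open>y = x powr (-1/2)\<close>; the exponent exceeds -1, so the bound is integrable at
    0.\<close>
  have "ln (x powr (-1/2)) \<le> x powr (-1/2) - 1"
    using assms by (intro ln_le_minus_one) auto
  moreover have "ln (x powr (-1/2)) = -ln x / 2"
    using assms by (simp add: ln_powr)
  moreover have "ln x \<le> 0" using assms by auto
  ultimately show ?thesis by linarith
qed

lemma nn_integral_abs_ln_unit: "(\<integral>\<^sup>+x. ennreal (\<bar>ln \<bar>x\<bar>\<bar> * indicator {-1..1} x) \<partial>lborel) < \<infinity>"
proof -
  define g where "g = (\<lambda>x::real. ennreal (2 * x powr (-1/2)) * indicator {0..1} x)"
  have [measurable]: "g \<in> borel_measurable borel" unfolding g_def by measurable
  have "((\<lambda>x::real. 2 * x powr (-1/2)) has_integral 2 * (1 powr (-1/2+1) / (-1/2+1))) {0..1}"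
    by (intro has_integral_mult_right has_integral_powr_from_0) auto
  hence "(\<integral>\<^sup>+x\<in>{0..1}. ennreal (2 * x powr (-1/2)) \<partial>lborel) = ennreal (2 * (1 powr (-1/2+1) / (-1/2+1)))"
    by (intro nn_integral_has_integral_lebesgue'[where f="\<lambda>x. 2 * x powr (-1/2)"]) auto
  hence fin: "(\<integral>\<^sup>+x. g x \<partial>lborel) < \<infinity>" unfolding g_def by simp
  have "(\<integral>\<^sup>+x. g (-x) \<partial>lborel) = (\<integral>\<^sup>+x. g x \<partial>distr lborel borel uminus)"
    by (subst nn_integral_distr) auto
  hence fin': "(\<integral>\<^sup>+x. g (-x) \<partial>lborel) < \<infinity>"
    using fin by (simp add: lborel_distr_uminus)
  have "(\<integral>\<^sup>+x. ennreal (\<bar>ln \<bar>x\<bar>\<bar> * indicator {-1..1} x) \<partial>lborel) \<le> (\<integral>\<^sup>+x. g x + g (-x) \<partial>lborel)"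
  proof (rule nn_integral_mono)
    fix x :: real
    show "ennreal (\<bar>ln \<bar>x\<bar>\<bar> * indicator {-1..1} x) \<le> g x + g (-x)"
    proof (cases "x = 0 \<or> x \<notin> {-1..1}")
      case False
      hence "ennreal (\<bar>ln \<bar>x\<bar>\<bar>) \<le> ennreal (2 * \<bar>x\<bar> powr (-1/2))"
        by (intro ennreal_leI abs_ln_le_powr) auto
      also have "\<dots> = g \<bar>x\<bar>" using False by (auto simp: g_def)
      also have "\<dots> \<le> g x + g (-x)" by (cases "x \<ge> 0") (auto simp: abs_if add_increasing add_increasing2)
      finally show ?thesis using False by auto
    qed auto
  qed
  also have "\<dots> = (\<integral>\<^sup>+x. g x \<partial>lborel) + (\<integral>\<^sup>+x. g (-x) \<partial>lborel)"
    by (rule nn_integral_add) auto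
  also have "\<dots> < \<infinity>" using fin fin' by (simp add: ennreal_add_eq_top less_top)
  finally show ?thesis .
qed

text \<open>The negative part of the logarithm vanishes off the unit disk, so unlike the logarithm
  itself it can be integrated over the whole plane.\<close>

definition neg_ln_cmod :: "complex \<Rightarrow> real" where
  "neg_ln_cmod z = max 0 (- ln (cmod z))"

text \<open>A universal constant that is never evaluated: by translation invariance it bounds the
  singularity of \<open>ln (cmod (z - a))\<close> for every centre a at once.\<close>

definition log_mass :: ennreal where
  "log_mass = (\<integral>\<^sup>+z. neg_ln_cmod z \<partial>lborel)"

lemma neg_ln_cmod_nonneg [simp]: "neg_ln_cmod z \<ge> 0"
  by (simp add: neg_ln_cmod_def)

lemma borel_measurable_neg_ln_cmod [measurable]: "neg_ln_cmod \<in> borel_measurable borel"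
  unfolding neg_ln_cmod_def by measurable

text \<open>Since \<open>\<bar>Re z\<bar> \<le> \<bar>z\<bar>\<close>, the two-dimensional integral is dominated by a one-dimensional one.\<close>

lemma log_mass_finite: "log_mass < \<infinity>"
proof -
  define h where "h = (\<lambda>b x. if b = (1::complex) then \<bar>ln \<bar>x\<bar>\<bar> * indicator {-1..1} x else indicator {-1..1::real} x :: real)"
  have "log_mass \<le> (\<integral>\<^sup>+z. (\<Prod>b\<in>Basis. ennreal (h b (z \<bullet> b))) \<partial>lborel)"
    unfolding log_mass_def
  proof (rule nn_integral_mono_AE)
    \<comment> \<open>Since \<open>ln 0 = 0\<close>, the comparison with
      \<open>\<bar>ln \<bar>Re z\<bar>\<bar>\<close> fails on the imaginary axis, which is therefore
      discarded as a null set.\<close>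
    have ae: "AE z::complex in lborel. Re z \<noteq> 0"
    proof (rule AE_I')
      have "{z::complex. 1 \<bullet> z = 0} \<in> null_sets lebesgue"
        using negligible_hyperplane[of "1::complex" 0] by (auto simp: negligible_iff_null_sets)
      moreover have "{z::complex. 1 \<bullet> z = 0} \<in> sets borel"
        by (auto intro!: borel_closed closed_hyperplane)
      ultimately show "{z::complex. 1 \<bullet> z = 0} \<in> null_sets lborel"
        by (auto simp: null_sets_def)
      show "{z \<in> space lborel. \<not> Re z \<noteq> 0} \<subseteq> {z::complex. 1 \<bullet> z = 0}"
        by (auto simp: inner_complex_def)
    qed
    show "AE z in lborel. ennreal (neg_ln_cmod z) \<le> (\<Prod>b\<in>Basis. ennreal (h b (z \<bullet> b)))"
    proof (rule AE_mp[OF ae AE_I2], intro impI)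
      fix z :: complex assume z: "Re z \<noteq> 0"
      show "ennreal (neg_ln_cmod z) \<le> (\<Prod>b\<in>Basis. ennreal (h b (z \<bullet> b)))"
      proof (cases "cmod z < 1")
        case True
        have "\<bar>Re z\<bar> \<le> cmod z" "\<bar>Im z\<bar> \<le> cmod z"
          by (auto simp: abs_Re_le_cmod abs_Im_le_cmod)
        hence le: "\<bar>Re z\<bar> \<le> 1" "\<bar>Im z\<bar> \<le> 1"
          using True by auto
        have "ln \<bar>Re z\<bar> \<le> ln (cmod z)"
          using z by (intro ln_mono abs_Re_le_cmod) auto
        moreover have "ln (cmod z) \<le> 0" using True z by (subst ln_le_zero_iff) auto
        ultimately have "neg_ln_cmod z \<le> \<bar>ln \<bar>Re z\<bar>\<bar>"
          by (auto simp: neg_ln_cmod_def)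
        moreover have "(\<Prod>b\<in>Basis. ennreal (h b (z \<bullet> b))) = ennreal \<bar>ln \<bar>Re z\<bar>\<bar>"
          using le by (simp add: Basis_complex_def h_def inner_complex_def indicator_def abs_le_iff)
        ultimately show ?thesis by (simp add: ennreal_leI)
      next
        case False
        hence "neg_ln_cmod z = 0" by (auto simp: neg_ln_cmod_def)
        thus ?thesis by simp
      qed
    qed
  qed
  also have "\<dots> = (\<Prod>b\<in>Basis. (\<integral>\<^sup>+x. ennreal (h b x) \<partial>lborel))"
    by (rule nn_integral_lborel_prod) (auto simp: h_def)
  also have "\<dots> = (\<integral>\<^sup>+x. ennreal (\<bar>ln \<bar>x\<bar>\<bar> * indicator {-1..1} x) \<partial>lborel) * (\<integral>\<^sup>+x. indicator {-1..1::real} x \<partial>lborel)"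
    by (simp add: Basis_complex_def h_def ennreal_indicator)
  also have "\<dots> < \<infinity>" using nn_integral_abs_ln_unit
    by (simp add: ennreal_mult_less_top)
  finally show ?thesis .
qed

lemma nn_integral_lborel_translate:
  fixes f :: "'a::euclidean_space \<Rightarrow> ennreal"
  assumes [measurable]: "f \<in> borel_measurable borel"
  shows "(\<integral>\<^sup>+z. f (w + z) \<partial>lborel) = (\<integral>\<^sup>+z. f z \<partial>lborel)"
  by (subst lborel_distr_plus[of w, symmetric], subst nn_integral_distr) auto

lemma integral_lborel_translate:
  fixes f :: "'a::euclidean_space \<Rightarrow> real"
  assumes [measurable]: "f \<in> borel_measurable borel"
  shows "(\<integral>z. f (w + z) \<partial>lborel) = (\<integral>z. f z \<partial>lborel)"
  by (subst lborel_distr_plus[of w, symmetric], subst integral_distr) auto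

lemma nn_integral_neg_ln_translate: "(\<integral>\<^sup>+z. neg_ln_cmod (w + z) \<partial>lborel) = log_mass"
  unfolding log_mass_def by (rule nn_integral_lborel_translate) auto

lemma abs_ln_cmod_le: "\<bar>ln (cmod z)\<bar> \<le> neg_ln_cmod z + cmod z"
proof (cases "z = 0")
  case False
  hence "ln (cmod z) \<le> cmod z - 1" by (intro ln_le_minus_one) auto
  with norm_ge_zero[of z] show ?thesis unfolding neg_ln_cmod_def max_def abs_if by (split if_split)+ linarith
qed (auto simp: neg_ln_cmod_def)
section \<open>Logarithmic potentials of compactly supported functions\<close>

lemma cball_in_sets_borel [measurable]: "cball (a :: 'a :: metric_space) r \<in> sets borel"
  by (intro borel_closed closed_cball)

text \<open>One inequality records the bound and the support with explicit constants, so that the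
  estimates derived from it are uniform over translates. Continuity is added only where values of
  \<psi> at nearby points are compared.\<close>

locale compact_bounded =
  fixes \<psi> :: "complex \<Rightarrow> real" and b B :: real
  assumes meas [measurable]: "\<psi> \<in> borel_measurable borel"
    and bound: "\<And>z. \<bar>\<psi> z\<bar> \<le> b * indicator (cball 0 B) z"
    and B_nonneg: "0 \<le> B"
begin

lemma b_nonneg: "0 \<le> b"
  using bound[of 0] B_nonneg abs_ge_zero[of "\<psi> 0"] by (simp add: indicator_def)

lemma abs_le_b: "\<bar>\<psi> z\<bar> \<le> b"
  using bound[of z] b_nonneg by (cases "cmod z \<le> B") auto

lemma zero_outside: "cmod z > B \<Longrightarrow> \<psi> z = 0"
  using bound[of z] by (auto simp: indicator_def)

lemma integrable: "integrable lborel \<psi>"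
proof (rule Bochner_Integration.integrable_bound)
  show "integrable lborel (\<lambda>z. b * indicator (cball 0 B) z :: real)"
    by (intro integrable_mult_right integrable_real_indicator emeasure_lborel_cball_finite) auto
  show "AE z in lborel. norm (\<psi> z) \<le> norm (b * indicator (cball 0 B) z :: real)"
    using bound b_nonneg by (intro AE_I2) (auto simp: abs_mult)
qed auto

text \<open>Splitting the logarithm into its negative part and a bound by the modulus keeps a out of
  the right-hand side except through A. Fubini needs this uniformity when a is random or runs along
  a circle.\<close>

lemma nn_integral_ln_le:
  assumes "cmod a \<le> A"
  shows "(\<integral>\<^sup>+z. ennreal \<bar>\<psi> z * ln (cmod (z - a))\<bar> \<partial>lborel)
           \<le> ennreal b * (log_mass + ennreal (B + A) * emeasure lborel (cball 0 B :: complex set))"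
proof -
  have "(\<integral>\<^sup>+z. ennreal \<bar>\<psi> z * ln (cmod (z - a))\<bar> \<partial>lborel)
     \<le> (\<integral>\<^sup>+z. ennreal b * (ennreal (neg_ln_cmod (-a + z)) + ennreal (B + A) * indicator (cball 0 B) z) \<partial>lborel)"
  proof (rule nn_integral_mono)
    fix z :: complex
    show "ennreal \<bar>\<psi> z * ln (cmod (z - a))\<bar>
       \<le> ennreal b * (ennreal (neg_ln_cmod (-a + z)) + ennreal (B + A) * indicator (cball 0 B) z)"
    proof (cases "z \<in> cball 0 B")
      case True
      have "cmod (z - a) \<le> cmod z + cmod a" by (rule norm_triangle_ineq4)
      also have "\<dots> \<le> B + A" using True assms by auto
      finally have "\<bar>ln (cmod (z - a))\<bar> \<le> neg_ln_cmod (z - a) + (B + A)"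
        using abs_ln_cmod_le[of "z - a"] by linarith
      hence "\<bar>\<psi> z * ln (cmod (z - a))\<bar> \<le> b * (neg_ln_cmod (z - a) + (B + A))"
        unfolding abs_mult using abs_le_b b_nonneg by (intro mult_mono) auto
      moreover have "0 \<le> B + A" using B_nonneg assms norm_ge_zero[of a] by linarith
      ultimately show ?thesis using True b_nonneg
        by (simp add: ennreal_leI flip: ennreal_plus ennreal_mult)
    next
      case False
      hence "\<psi> z = 0" using zero_outside by auto
      thus ?thesis by simp
    qed
  qed
  also have "\<dots> = ennreal b * (log_mass + ennreal (B + A) * emeasure lborel (cball 0 B :: complex set))"
  proof -
    have m: "(\<lambda>z. ennreal (neg_ln_cmod (-a + z))) \<in> borel_measurable lborel"
      "(\<lambda>z. ennreal (B + A) * indicator (cball 0 B) z) \<in> borel_measurable (lborel :: complex measure)"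
      by measurable
    show ?thesis
      by (simp only: nn_integral_cmult nn_integral_add borel_measurable_add m
            nn_integral_neg_ln_translate) (simp add: nn_integral_cmult)
  qed
  finally show ?thesis .
qed

lemma nn_integral_ln_bound_finite:
  "ennreal b * (log_mass + ennreal (B + A) * emeasure lborel (cball 0 B :: complex set)) < \<infinity>"
  using log_mass_finite emeasure_lborel_cball_finite[of "0::complex" B]
  by (auto simp: ennreal_mult_less_top)

lemma integrable_ln: "integrable lborel (\<lambda>z. \<psi> z * ln (cmod (z - a)))"
proof (rule integrableI_bounded)
  have "(\<integral>\<^sup>+z. ennreal (norm (\<psi> z * ln (cmod (z - a)))) \<partial>lborel)
      \<le> ennreal b * (log_mass + ennreal (B + cmod a) * emeasure lborel (cball 0 B :: complex set))"
    using nn_integral_ln_le[of a "cmod a"] by simp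
  also have "\<dots> < \<infinity>" by (rule nn_integral_ln_bound_finite)
  finally show "(\<integral>\<^sup>+z. ennreal (norm (\<psi> z * ln (cmod (z - a)))) \<partial>lborel) < \<infinity>" .
qed auto

end

section \<open>Potentials and circle means\<close>

definition log_pot :: "(complex \<Rightarrow> real) \<Rightarrow> complex \<Rightarrow> real" where
  "log_pot \<psi> a = (\<integral>z. \<psi> z * ln (cmod (z - a)) \<partial>lborel)"

text \<open>Convolution of f with the uniform law on the circle of radius r, written as an average
  of translates so that translation invariance of Lebesgue measure applies directly.\<close>

definition circle_mean :: "real \<Rightarrow> (complex \<Rightarrow> real) \<Rightarrow> complex \<Rightarrow> real" where
  "circle_mean r f z = (\<integral>x. f (- of_real r * ecis x + z) \<partial>unif01)"

interpretation lborel_unif01: pair_sigma_finite "lborel :: complex measure" unif01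
  by standard

lemma ecis_measurable [measurable]: "(\<lambda>x. ecis x) \<in> borel_measurable borel"
  by (intro borel_measurable_continuous_onI continuous_intros)

lemma AE_lborel_cmod_neq: "AE z in lborel. cmod (z - a) \<noteq> r"
proof (rule AE_I')
  have "sphere a r \<in> null_sets lebesgue"
    using negligible_sphere[of a r] by (auto simp: negligible_iff_null_sets)
  moreover have "sphere a r \<in> sets borel" by (auto intro!: borel_closed)
  ultimately show "sphere a r \<in> null_sets lborel" by (auto simp: null_sets_def)
  show "{z \<in> space lborel. \<not> cmod (z - a) \<noteq> r} \<subseteq> sphere a r"
    by (auto simp: dist_norm norm_minus_commute)
qed

context compact_bounded
begin

lemma compact_bounded_translate:
  assumes "cmod w \<le> r"
  shows "compact_bounded (\<lambda>z. \<psi> (w + z)) b (B + r)"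
proof
  have "0 \<le> r" using assms norm_ge_zero[of w] by linarith
  thus "0 \<le> B + r" using B_nonneg by auto
  fix z
  show "\<bar>\<psi> (w + z)\<bar> \<le> b * indicator (cball 0 (B + r)) z"
  proof (cases "cmod z \<le> B + r")
    case False
    have "cmod z \<le> cmod (w + z) + cmod w" using norm_triangle_ineq4[of "w + z" w] by simp
    hence "cmod (w + z) > B" using False assms by linarith
    thus ?thesis using zero_outside b_nonneg by (auto simp: indicator_def)
  qed (auto simp: abs_le_b)
qed auto

lemma compact_bounded_circle_mean:
  assumes "0 \<le> r"
  shows "compact_bounded (circle_mean r \<psi>) b (B + r)"
proof
  show "circle_mean r \<psi> \<in> borel_measurable borel"
    unfolding circle_mean_def by measurable
  show "0 \<le> B + r" using B_nonneg assms by auto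
  fix z
  have *: "\<bar>\<psi> (- of_real r * ecis x + z)\<bar> \<le> b * indicator (cball 0 (B + r)) z" for x
    using compact_bounded.bound[OF compact_bounded_translate, of "- of_real r * ecis x" r z] assms
    by (simp add: norm_mult)
  have "\<bar>circle_mean r \<psi> z\<bar> \<le> (\<integral>x. \<bar>\<psi> (- of_real r * ecis x + z)\<bar> \<partial>unif01)"
    unfolding circle_mean_def by (rule integral_abs_bound)
  also have "\<dots> \<le> (\<integral>x. b * indicator (cball 0 (B + r)) z \<partial>unif01)"
    using * by (intro integral_mono_AE unif01.integrable_const_bound[where B=b] AE_I2)
               (use abs_le_b b_nonneg in \<open>auto simp: indicator_def\<close>)
  also have "\<dots> = b * indicator (cball 0 (B + r)) z"
    by (simp add: unif01.prob_space)
  finally show "\<bar>circle_mean r \<psi> z\<bar> \<le> b * indicator (cball 0 (B + r)) z" .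
qed

text \<open>Convolution with a probability measure preserves the total integral, by Fubini and
  translation invariance; hence the difference of two circle means has mean zero.\<close>

lemma integral_circle_mean:
  assumes "0 \<le> r"
  shows "(\<integral>z. circle_mean r \<psi> z \<partial>lborel) = (\<integral>z. \<psi> z \<partial>lborel)"
proof -
  have "integrable (lborel \<Otimes>\<^sub>M unif01) (\<lambda>(z, x). \<psi> (- of_real r * ecis x + z))"
  proof (rule integrableI_bounded)
    have "(\<integral>\<^sup>+p. ennreal (norm (case p of (z, x) \<Rightarrow> \<psi> (- of_real r * ecis x + z))) \<partial>(lborel \<Otimes>\<^sub>M unif01))
        = (\<integral>\<^sup>+x. \<integral>\<^sup>+z. ennreal \<bar>\<psi> (- of_real r * ecis x + z)\<bar> \<partial>lborel \<partial>unif01)"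
      by (subst lborel_unif01.nn_integral_snd[symmetric]) auto
    also have "\<dots> = (\<integral>\<^sup>+x. \<integral>\<^sup>+z. ennreal \<bar>\<psi> z\<bar> \<partial>lborel \<partial>unif01)"
      by (intro nn_integral_cong nn_integral_lborel_translate) auto
    also have "\<dots> < \<infinity>"
      using integrable by (simp add: integrable_iff_bounded unif01.emeasure_space_1[simplified])
    finally show "(\<integral>\<^sup>+p. ennreal (norm (case p of (z, x) \<Rightarrow> \<psi> (- of_real r * ecis x + z))) \<partial>(lborel \<Otimes>\<^sub>M unif01)) < \<infinity>" .
  qed measurable
  from lborel_unif01.Fubini_integral[OF this]
  have "(\<integral>z. circle_mean r \<psi> z \<partial>lborel) = (\<integral>x. \<integral>z. \<psi> (- of_real r * ecis x + z) \<partial>lborel \<partial>unif01)"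
    by (simp add: circle_mean_def)
  also have "\<dots> = (\<integral>x. \<integral>z. \<psi> z \<partial>lborel \<partial>unif01)"
    by (intro Bochner_Integration.integral_cong refl integral_lborel_translate) auto
  finally show ?thesis by (simp add: unif01.prob_space[simplified])
qed

text \<open>The average can be moved from the density to the kernel. Averaged over a circle of
  radius r, the logarithm loses its singularity and becomes a truncated logarithm, the potential of
  the uniform law on that circle. The order of integration is exchanged both before and after the
  shift of the plane, whence two integrability claims.\<close>

lemma log_pot_circle_mean:
  assumes "0 \<le> r"
  shows "log_pot (circle_mean r \<psi>) a = (\<integral>c. \<psi> c * ln (max r (cmod (c - a))) \<partial>lborel)"
proof -
  have tr: "compact_bounded (\<lambda>z. \<psi> (- of_real r * ecis x + z)) b (B + r)" for x
    using compact_bounded_translate[of "- of_real r * ecis x" r] assms by (simp add: norm_mult)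
  define C1 where "C1 = ennreal b * (log_mass + ennreal (B + r + cmod a) * emeasure lborel (cball 0 (B + r) :: complex set))"
  define C2 where "C2 = ennreal b * (log_mass + ennreal (B + (r + cmod a)) * emeasure lborel (cball 0 B :: complex set))"
  have int1: "integrable (lborel \<Otimes>\<^sub>M unif01) (\<lambda>(z, x). \<psi> (- of_real r * ecis x + z) * ln (cmod (z - a)))"
  proof (rule integrableI_bounded)
    have "(\<integral>\<^sup>+p. ennreal (norm (case p of (z, x) \<Rightarrow> \<psi> (- of_real r * ecis x + z) * ln (cmod (z - a)))) \<partial>(lborel \<Otimes>\<^sub>M unif01))
        = (\<integral>\<^sup>+x. \<integral>\<^sup>+z. ennreal \<bar>\<psi> (- of_real r * ecis x + z) * ln (cmod (z - a))\<bar> \<partial>lborel \<partial>unif01)"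
      by (subst lborel_unif01.nn_integral_snd[symmetric]) auto
    also have "\<dots> \<le> (\<integral>\<^sup>+x. C1 \<partial>unif01)"
      unfolding C1_def by (intro nn_integral_mono compact_bounded.nn_integral_ln_le[OF tr]) auto
    also have "\<dots> < \<infinity>"
      using compact_bounded.nn_integral_ln_bound_finite[OF tr]
      by (simp add: unif01.emeasure_space_1[simplified] C1_def)
    finally show "(\<integral>\<^sup>+p. ennreal (norm (case p of (z, x) \<Rightarrow> \<psi> (- of_real r * ecis x + z) * ln (cmod (z - a)))) \<partial>(lborel \<Otimes>\<^sub>M unif01)) < \<infinity>" .
  qed measurable
  have int2: "integrable (lborel \<Otimes>\<^sub>M unif01) (\<lambda>(c, x). \<psi> c * ln (cmod (c - a + of_real r * ecis x)))"
  proof (rule integrableI_bounded)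
    have "(\<integral>\<^sup>+p. ennreal (norm (case p of (c, x) \<Rightarrow> \<psi> c * ln (cmod (c - a + of_real r * ecis x)))) \<partial>(lborel \<Otimes>\<^sub>M unif01))
        = (\<integral>\<^sup>+x. \<integral>\<^sup>+c. ennreal \<bar>\<psi> c * ln (cmod (c - (a - of_real r * ecis x)))\<bar> \<partial>lborel \<partial>unif01)"
      by (subst lborel_unif01.nn_integral_snd[symmetric]) (auto simp: diff_diff_eq2 diff_add_eq)
    also have "\<dots> \<le> (\<integral>\<^sup>+x. C2 \<partial>unif01)"
      unfolding C2_def
    proof (intro nn_integral_mono nn_integral_ln_le)
      fix x show "cmod (a - of_real r * ecis x) \<le> r + cmod a"
        using norm_triangle_ineq4[of a "of_real r * ecis x"] assms by (simp add: norm_mult)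
    qed
    also have "\<dots> < \<infinity>"
      using nn_integral_ln_bound_finite by (simp add: unif01.emeasure_space_1[simplified] C2_def)
    finally show "(\<integral>\<^sup>+p. ennreal (norm (case p of (c, x) \<Rightarrow> \<psi> c * ln (cmod (c - a + of_real r * ecis x)))) \<partial>(lborel \<Otimes>\<^sub>M unif01)) < \<infinity>" .
  qed measurable
  have "log_pot (circle_mean r \<psi>) a = (\<integral>z. \<integral>x. \<psi> (- of_real r * ecis x + z) * ln (cmod (z - a)) \<partial>unif01 \<partial>lborel)"
    unfolding log_pot_def circle_mean_def by simp
  also have "\<dots> = (\<integral>x. \<integral>z. \<psi> (- of_real r * ecis x + z) * ln (cmod (z - a)) \<partial>lborel \<partial>unif01)"
    using lborel_unif01.Fubini_integral[OF int1] by simp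
  also have "\<dots> = (\<integral>x. \<integral>c. \<psi> c * ln (cmod (c - a + of_real r * ecis x)) \<partial>lborel \<partial>unif01)"
  proof (rule Bochner_Integration.integral_cong[OF refl])
    fix x
    show "(\<integral>z. \<psi> (- of_real r * ecis x + z) * ln (cmod (z - a)) \<partial>lborel)
        = (\<integral>c. \<psi> c * ln (cmod (c - a + of_real r * ecis x)) \<partial>lborel)"
      by (subst (2) integral_lborel_translate[of _ "- of_real r * ecis x", symmetric])
         (auto simp: algebra_simps)
  qed
  also have "\<dots> = (\<integral>c. \<integral>x. \<psi> c * ln (cmod (c - a + of_real r * ecis x)) \<partial>unif01 \<partial>lborel)"
    using lborel_unif01.Fubini_integral[OF int2] by simp
  also have "\<dots> = (\<integral>c. \<psi> c * ln (max r (cmod (c - a))) \<partial>lborel)"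
  proof (rule Bochner_Integration.integral_cong_AE)
    show "AE c in lborel. (\<integral>x. \<psi> c * ln (cmod (c - a + of_real r * ecis x)) \<partial>unif01)
                    = \<psi> c * ln (max r (cmod (c - a)))"
      using AE_lborel_cmod_neq[of a r]
    proof (rule AE_mp, intro AE_I2 impI)
      fix c assume "cmod (c - a) \<noteq> r"
      thus "(\<integral>x. \<psi> c * ln (cmod (c - a + of_real r * ecis x)) \<partial>unif01)
                    = \<psi> c * ln (max r (cmod (c - a)))"
        using circle_average_ln(2)[OF assms, of "c - a"] by simp
    qed
  qed measurable
  finally show ?thesis .
qed

end

section \<open>Approximation of test functions by potentials\<close>

lemma log_pot_scaled_diff:
  assumes "compact_bounded \<psi>1 b1 B1" "compact_bounded \<psi>2 b2 B2"
  shows "log_pot (\<lambda>z. (\<psi>1 z - \<psi>2 z) / I) a = (log_pot \<psi>1 a - log_pot \<psi>2 a) / I"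
  unfolding log_pot_def
  using compact_bounded.integrable_ln[OF assms(1), of a] compact_bounded.integrable_ln[OF assms(2), of a]
  by (simp add: diff_divide_distrib left_diff_distrib)

lemma compact_bounded_scaled_diff:
  assumes "compact_bounded \<psi>1 b1 B1" "compact_bounded \<psi>2 b2 B2" "I > 0"
  shows "compact_bounded (\<lambda>z. (\<psi>1 z - \<psi>2 z) / I) ((b1 + b2) / I) (max B1 B2)"
proof -
  interpret a: compact_bounded \<psi>1 b1 B1 by fact
  interpret b: compact_bounded \<psi>2 b2 B2 by fact
  show ?thesis
  proof
    show "0 \<le> max B1 B2" using a.B_nonneg by simp
    fix z
    have "\<bar>\<psi>1 z - \<psi>2 z\<bar> \<le> (b1 + b2) * indicator (cball 0 (max B1 B2)) z"
    proof (cases "cmod z \<le> max B1 B2")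
      case True
      thus ?thesis using a.abs_le_b[of z] b.abs_le_b[of z] by auto
    next
      case False
      thus ?thesis using a.zero_outside[of z] b.zero_outside[of z] by auto
    qed
    thus "\<bar>(\<psi>1 z - \<psi>2 z) / I\<bar> \<le> (b1 + b2) / I * indicator (cball 0 (max B1 B2)) z"
      using assms(3) by (simp add: abs_divide divide_right_mono)
  qed measurable
qed

text \<open>Equal to \<open>ln 2\<close> for \<open>cmod z \<le> r\<close>, and to 0 for
  \<open>cmod z \<ge> 2 * r\<close>, where the two truncated logarithms agree. Divided by its
  integral it is an approximate identity as r tends to 0.\<close>

definition log_bump :: "real \<Rightarrow> complex \<Rightarrow> real" where
  "log_bump r z = ln (max (2 * r) (cmod z)) - ln (max r (cmod z))"

context
  fixes r :: real assumes r: "r > 0"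
begin

lemma log_bump_nonneg: "log_bump r z \<ge> 0"
proof -
  have "ln (max r (cmod z)) \<le> ln (max (2 * r) (cmod z))" using r by (intro ln_mono) auto
  thus ?thesis by (simp add: log_bump_def)
qed

lemma compact_bounded_log_bump: "compact_bounded (log_bump r) (ln 2) (2 * r)"
proof
  show "log_bump r \<in> borel_measurable borel" unfolding log_bump_def by measurable
  fix z
  show "\<bar>log_bump r z\<bar> \<le> ln 2 * indicator (cball 0 (2 * r)) z"
  proof (cases "cmod z \<le> 2 * r")
    case True
    have "ln (max r (cmod z)) \<ge> ln r" using r by (intro ln_mono) auto
    moreover have "max (2 * r) (cmod z) = 2 * r" using True by auto
    moreover have "ln (2 * r) = ln 2 + ln r" using r by (simp add: ln_mult)
    ultimately have "log_bump r z \<le> ln 2" unfolding log_bump_def by simp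
    thus ?thesis using True log_bump_nonneg[of z] by simp
  qed (use r in \<open>auto simp: log_bump_def\<close>)
qed (use r in auto)

lemma integral_log_bump_pos: "(\<integral>z. log_bump r z \<partial>lborel) > 0"
proof -
  have "0 < ln 2 * measure lborel (ball (0::complex) r)"
    using r content_ball_pos[of r "0::complex"] by simp
  also have "\<dots> = (\<integral>z. ln 2 * indicator (ball (0::complex) r) z \<partial>lborel)"
    by simp
  also have "\<dots> \<le> (\<integral>z. log_bump r z \<partial>lborel)"
  proof (rule integral_mono)
    show "integrable lborel (\<lambda>z. ln 2 * indicator (ball (0::complex) r) z :: real)"
      by (intro integrable_mult_right integrable_real_indicator emeasure_lborel_ball_finite) auto
    show "integrable lborel (log_bump r)"
      using compact_bounded.integrable[OF compact_bounded_log_bump] .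
    fix z :: complex
    show "ln 2 * indicator (ball (0::complex) r) z \<le> log_bump r z"
    proof (cases "cmod z < r")
      case True
      hence "max (2 * r) (cmod z) = 2 * r" "max r (cmod z) = r" using r by auto
      thus ?thesis using True r by (simp add: log_bump_def ln_mult)
    qed (use log_bump_nonneg in auto)
  qed
  finally show ?thesis .
qed

end

lemma (in compact_bounded) integrable_ln_max:
  assumes "r > 0"
  shows "integrable lborel (\<lambda>c. \<psi> c * ln (max r (cmod (c - a))))"
proof (rule Bochner_Integration.integrable_bound)
  \<comment> \<open>The truncated logarithm is always one of \<open>ln r\<close> and
    \<open>ln (cmod (c - a))\<close>, so the sum of both absolute values dominates.\<close>
  show "integrable lborel (\<lambda>c. \<bar>\<psi> c * ln r\<bar> + \<bar>\<psi> c * ln (cmod (c - a))\<bar>)"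
    using integrable integrable_ln[of a] by (intro Bochner_Integration.integrable_add integrable_abs) auto
  show "AE c in lborel. norm (\<psi> c * ln (max r (cmod (c - a)))) \<le> norm (\<bar>\<psi> c * ln r\<bar> + \<bar>\<psi> c * ln (cmod (c - a))\<bar>)"
    by (intro AE_I2) (auto simp: max_def)
qed measurable

text \<open>Continuity is uniform on compact sets. With the disk enlarged by 1 and the distance
  capped at 1, two close points either both lie in that disk or both lie outside the
  support.\<close>

lemma (in compact_bounded) uniformly_continuous:
  assumes "continuous_on UNIV \<psi>" "\<epsilon> > 0"
  shows "\<exists>\<delta>>0. \<forall>x y. dist y x < \<delta> \<longrightarrow> \<bar>\<psi> y - \<psi> x\<bar> < \<epsilon>"
proof -
  have "uniformly_continuous_on (cball 0 (B + 1)) \<psi>"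
    using assms(1) by (intro compact_uniformly_continuous continuous_on_subset[OF assms(1)]) auto
  then obtain d where d: "d > 0" "\<And>x y. x \<in> cball 0 (B + 1) \<Longrightarrow> y \<in> cball 0 (B + 1) \<Longrightarrow> dist y x < d \<Longrightarrow> \<bar>\<psi> y - \<psi> x\<bar> < \<epsilon>"
    using assms(2) unfolding uniformly_continuous_on_def dist_real_def by metis
  have "\<bar>\<psi> y - \<psi> x\<bar> < \<epsilon>" if *: "dist y x < min d 1" for x y
  proof (cases "cmod x \<le> B \<or> cmod y \<le> B")
    case True
    have "cmod x \<le> cmod y + dist y x" "cmod y \<le> cmod x + dist y x"
      using norm_triangle_sub[of x y] norm_triangle_sub[of y x] by (auto simp: dist_norm norm_minus_commute)
    hence "cmod x \<le> B + 1" "cmod y \<le> B + 1" using True * by auto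
    thus ?thesis using d(2)[of x y] * by auto
  next
    case False
    thus ?thesis using zero_outside[of x] zero_outside[of y] assms(2) by auto
  qed
  thus ?thesis using d(1) by (intro exI[of _ "min d 1"]) auto
qed

text \<open>The difference of the circle means of radii \<open>2r\<close> and \<open>r\<close> has as its logarithmic potential
  the convolution of \<open>f\<close> with a compactly supported bump, by the circle average of \<open>ln \<bar>z - a\<bar>\<close>.\<close>

lemma (in compact_bounded) ex_log_pot_approx:
  assumes cont: "continuous_on UNIV \<psi>" and eps: "\<epsilon> > 0"
  shows "\<exists>\<phi> b' B'. compact_bounded \<phi> b' B' \<and> (\<integral>z. \<phi> z \<partial>lborel) = 0 \<and> (\<forall>a. \<bar>\<psi> a - log_pot \<phi> a\<bar> \<le> \<epsilon>)"
proof -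
  obtain \<delta> where \<delta>: "\<delta> > 0" "\<And>x y. dist y x < \<delta> \<Longrightarrow> \<bar>\<psi> y - \<psi> x\<bar> < \<epsilon>"
    using uniformly_continuous[OF cont eps] by blast
  \<comment> \<open>The bump lives on the disk of radius 2 r, which must stay within
    \<delta>.\<close>
  define r where "r = \<delta> / 3"
  have r: "r > 0" using \<delta> by (simp add: r_def)
  define I where "I = (\<integral>z. log_bump r z \<partial>lborel)"
  have I: "I > 0" unfolding I_def by (rule integral_log_bump_pos[OF r])
  note lb = compact_bounded_log_bump[OF r]
  define \<phi> where "\<phi> = (\<lambda>z. (circle_mean (2 * r) \<psi> z - circle_mean r \<psi> z) / I)"
  note cm1 = compact_bounded_circle_mean[of "2 * r"] and cm2 = compact_bounded_circle_mean[of r]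
  have 1: "compact_bounded \<phi> ((b + b) / I) (max (B + 2 * r) (B + r))"
    unfolding \<phi>_def using r by (intro compact_bounded_scaled_diff cm1 cm2 I) auto
  have 2: "(\<integral>z. \<phi> z \<partial>lborel) = 0"
    unfolding \<phi>_def using r compact_bounded.integrable[OF cm1] compact_bounded.integrable[OF cm2]
    by (simp add: integral_circle_mean)
  have 3: "\<bar>\<psi> a - log_pot \<phi> a\<bar> \<le> \<epsilon>" for a
  proof -
    have "log_pot \<phi> a = (log_pot (circle_mean (2 * r) \<psi>) a - log_pot (circle_mean r \<psi>) a) / I"
      unfolding \<phi>_def using r by (intro log_pot_scaled_diff[OF cm1 cm2]) auto
    also have "log_pot (circle_mean (2 * r) \<psi>) a - log_pot (circle_mean r \<psi>) a
      = (\<integral>c. \<psi> c * ln (max (2 * r) (cmod (c - a))) \<partial>lborel) - (\<integral>c. \<psi> c * ln (max r (cmod (c - a))) \<partial>lborel)"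
      using r by (simp add: log_pot_circle_mean)
    also have "\<dots> = (\<integral>c. \<psi> c * log_bump r (c - a) \<partial>lborel)"
      using r unfolding log_bump_def right_diff_distrib
      by (intro Bochner_Integration.integral_diff[symmetric] integrable_ln_max) auto
    also have "\<dots> = (\<integral>c. \<psi> (a + c) * log_bump r c \<partial>lborel)"
      using compact_bounded.meas[OF lb]
      by (subst integral_lborel_translate[of _ a, symmetric]) auto
    finally have *: "log_pot \<phi> a = (\<integral>c. \<psi> (a + c) * log_bump r c \<partial>lborel) / I" .
    have intl: "integrable lborel (log_bump r)" by (rule compact_bounded.integrable[OF lb])
    have int: "integrable lborel (\<lambda>c. \<psi> (a + c) * log_bump r c)"
    proof (rule Bochner_Integration.integrable_bound)
      show "integrable lborel (\<lambda>c. b * log_bump r c)" using intl by auto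
      show "(\<lambda>c. \<psi> (a + c) * log_bump r c) \<in> borel_measurable lborel"
        using compact_bounded.meas[OF lb] by measurable
      show "AE c in lborel. norm (\<psi> (a + c) * log_bump r c) \<le> norm (b * log_bump r c)"
        using abs_le_b b_nonneg by (intro AE_I2) (auto simp: abs_mult intro!: mult_right_mono)
    qed
    \<comment> \<open>As \<open>I\<close> is the integral of the bump, the difference is the
      integral of \<open>\<psi> a - \<psi> (a + c)\<close> weighted by the bump.\<close>
    have "\<bar>I * \<psi> a - (\<integral>c. \<psi> (a + c) * log_bump r c \<partial>lborel)\<bar> = \<bar>(\<integral>c. \<psi> a * log_bump r c - \<psi> (a + c) * log_bump r c \<partial>lborel)\<bar>"
      using int intl by (simp add: I_def mult.commute)
    also have "\<dots> \<le> (\<integral>c. \<bar>\<psi> a * log_bump r c - \<psi> (a + c) * log_bump r c\<bar> \<partial>lborel)"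
      by (rule integral_abs_bound)
    also have "\<dots> \<le> (\<integral>c. \<epsilon> * log_bump r c \<partial>lborel)"
    proof (rule integral_mono)
      show "integrable lborel (\<lambda>c. \<bar>\<psi> a * log_bump r c - \<psi> (a + c) * log_bump r c\<bar>)"
        using int intl by auto
      show "integrable lborel (\<lambda>c. \<epsilon> * log_bump r c)" using intl by auto
      fix c
      show "\<bar>\<psi> a * log_bump r c - \<psi> (a + c) * log_bump r c\<bar> \<le> \<epsilon> * log_bump r c"
      proof (cases "cmod c \<le> 2 * r")
        case True
        hence "dist a (a + c) < \<delta>" using \<delta>(1) by (simp add: dist_norm r_def)
        from \<delta>(2)[OF this] have "\<bar>\<psi> a - \<psi> (a + c)\<bar> \<le> \<epsilon>" by simp
        hence "\<bar>\<psi> a - \<psi> (a + c)\<bar> * \<bar>log_bump r c\<bar> \<le> \<epsilon> * \<bar>log_bump r c\<bar>"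
          by (intro mult_right_mono) auto
        thus ?thesis using log_bump_nonneg[OF r, of c] by (simp add: abs_mult flip: left_diff_distrib)
      next
        case False
        thus ?thesis using compact_bounded.zero_outside[OF lb, of c] by simp
      qed
    qed
    also have "\<dots> = \<epsilon> * I" by (simp add: I_def)
    finally have "\<bar>I * \<psi> a - (\<integral>c. \<psi> (a + c) * log_bump r c \<partial>lborel)\<bar> / I \<le> \<epsilon>"
      using I by (simp add: divide_le_eq)
    moreover have "\<psi> a - log_pot \<phi> a = (I * \<psi> a - (\<integral>c. \<psi> (a + c) * log_bump r c \<partial>lborel)) / I"
      unfolding * using I by (simp add: field_simps)
    ultimately show ?thesis using I by simp
  qed
  from 1 2 3 show ?thesis by blast
qed

section \<open>Potentials of root measures\<close>

lemma expectation_pmf_of_multiset: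
  fixes g :: "'a \<Rightarrow> real"
  assumes "A \<noteq> {#}"
  shows "(\<integral>x. g x \<partial>measure_pmf (pmf_of_multiset A)) = (\<Sum>x\<in>#A. g x) / size A"
proof -
  have "(\<integral>x. g x \<partial>measure_pmf (pmf_of_multiset A)) = (\<Sum>x\<in>set_mset A. pmf (pmf_of_multiset A) x *\<^sub>R g x)"
    using assms by (intro integral_measure_pmf) auto
  also have "\<dots> = (\<Sum>x\<in>set_mset A. count A x * g x) / size A"
    using assms by (simp add: sum_divide_distrib)
  also have "(\<Sum>x\<in>set_mset A. count A x * g x) = (\<Sum>x\<in>#A. g x)"
  proof -
    \<comment> \<open>The index set is kept at a fixed superset S, so that the induction over the
      multiset changes only the multiplicities.\<close>
    have "(\<Sum>x\<in>S. real (count A x) * g x) = (\<Sum>x\<in>#A. g x)" if "finite S" "set_mset A \<subseteq> S" for S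
      using that(2)
    proof (induction A)
      case (add a A)
      have "(\<Sum>x\<in>S. real (count (add_mset a A) x) * g x) = (\<Sum>x\<in>S. real (count A x) * g x + (if x = a then g x else 0))"
        by (intro sum.cong refl) (auto simp: algebra_simps)
      thus ?case using add that(1) by (simp add: sum.distrib)
    qed auto
    thus ?thesis by blast
  qed
  finally show ?thesis .
qed

lemma ln_cmod_prod_mset:
  assumes "\<And>a. a \<in># A \<Longrightarrow> z \<noteq> a"
  shows "ln (cmod (\<Prod>a\<in>#A. z - a)) = (\<Sum>a\<in>#A. ln (cmod (z - a)))"
  using assms
proof (induction A)
  case (add x A)
  have "(\<Prod>a\<in>#A. z - a) \<noteq> 0" using add.prems by auto
  thus ?case using add by (simp add: norm_mult ln_mult)
qed auto

text \<open>Off the finitely many zeros, the logarithm of the polynomial is a constant plus a sum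
  over the roots; the mean-zero density removes the constant, which holds the leading
  coefficient.\<close>

lemma (in compact_bounded) integral_ln_poly:
  assumes p: "p \<noteq> 0" and zero: "(\<integral>z. \<psi> z \<partial>lborel) = 0"
  shows "integrable lborel (\<lambda>z. \<psi> z * ln (cmod (poly p z)))" (is ?A)
    and "(\<integral>z. \<psi> z * ln (cmod (poly p z)) \<partial>lborel) = (\<Sum>a\<in>#proots p. log_pot \<psi> a)" (is ?B)
proof -
  define g where "g = (\<lambda>z. \<psi> z * ln (cmod (lead_coeff p)) + (\<Sum>a\<in>#proots p. \<psi> z * ln (cmod (z - a))))"
  have ms: "integrable lborel (\<lambda>z. \<Sum>a\<in>#A. \<psi> z * ln (cmod (z - a))) \<and>
       (\<integral>z. (\<Sum>a\<in>#A. \<psi> z * ln (cmod (z - a))) \<partial>lborel) = (\<Sum>a\<in>#A. log_pot \<psi> a)" for A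
    by (induction A) (use integrable_ln in \<open>auto simp: log_pot_def\<close>)
  have int_g: "integrable lborel g" unfolding g_def using integrable ms by auto
  have val_g: "(\<integral>z. g z \<partial>lborel) = (\<Sum>a\<in>#proots p. log_pot \<psi> a)"
    unfolding g_def using integrable ms[of "proots p"] zero by auto
  have meas_p [measurable]: "(\<lambda>z. poly p z) \<in> borel_measurable borel"
    by (intro borel_measurable_continuous_onI continuous_intros)
  have "finite {z. poly p z = 0}" using p by (simp add: poly_roots_finite)
  hence ae: "AE z in lborel. poly p z \<noteq> 0"
    by (intro AE_I'[of "{z. poly p z = 0}"] finite_imp_null_set_lborel) auto
  have eq: "AE z in lborel. g z = \<psi> z * ln (cmod (poly p z))"
    using ae
  proof (rule AE_mp, intro AE_I2 impI)
    fix z assume z: "poly p z \<noteq> 0"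
    have "poly p z = poly (smult (lead_coeff p) (\<Prod>a\<in>#proots p. [:-a, 1:])) z"
      by (simp add: complex_poly_decompose_multiset)
    hence "poly p z = lead_coeff p * (\<Prod>a\<in>#proots p. z - a)"
      by (simp add: poly_prod_mset image_mset.compositionality o_def)
    moreover have "z \<noteq> a" if "a \<in># proots p" for a using z p that by auto
    moreover have "(\<Prod>a\<in>#proots p. z - a) \<noteq> 0" using z p by auto
    ultimately have "ln (cmod (poly p z)) = ln (cmod (lead_coeff p)) + (\<Sum>a\<in>#proots p. ln (cmod (z - a)))"
      using p ln_cmod_prod_mset[of "proots p" z] by (simp add: norm_mult ln_mult)
    thus "g z = \<psi> z * ln (cmod (poly p z))"
      by (simp add: g_def distrib_left sum_mset_distrib_left)
  qed
  show ?A using int_g eq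
    by (subst integrable_cong_AE[where g=g]) (auto simp: g_def dest: borel_measurable_integrable)
  show ?B unfolding val_g[symmetric] using eq int_g
    by (intro integral_cong_AE) (auto dest: borel_measurable_integrable)
qed
section \<open>Random sums with Gaussian coefficients\<close>

lemma nn_integral_std_complex_gaussian:
  assumes [measurable]: "g \<in> borel_measurable borel"
  shows "(\<integral>\<^sup>+z. g z \<partial>std_complex_gaussian) = (\<integral>\<^sup>+z. ennreal (exp (- (cmod z)\<^sup>2) / pi) * g z \<partial>lborel)"
  unfolding std_complex_gaussian_def by (subst nn_integral_density) auto

lemma sets_std_complex_gaussian [measurable_cong]: "sets std_complex_gaussian = sets borel"
  unfolding std_complex_gaussian_def by simp

text \<open>The density is at most 1. Exchanging the Gaussian law for Lebesgue measure buys
  translation invariance.\<close>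

lemma nn_integral_std_complex_gaussian_le:
  assumes [measurable]: "g \<in> borel_measurable borel"
  shows "(\<integral>\<^sup>+z. g z \<partial>std_complex_gaussian) \<le> (\<integral>\<^sup>+z. g z \<partial>lborel)"
  unfolding nn_integral_std_complex_gaussian[OF assms]
proof (rule nn_integral_mono)
  fix z :: complex
  have "exp (- (cmod z)\<^sup>2) \<le> 1" by simp
  hence "exp (- (cmod z)\<^sup>2) \<le> pi" using pi_gt3 by linarith
  hence "exp (- (cmod z)\<^sup>2) / pi \<le> 1" by simp
  hence "ennreal (exp (- (cmod z)\<^sup>2) / pi) * g z \<le> 1 * g z"
    by (intro mult_right_mono) (auto simp: ennreal_le_1)
  thus "ennreal (exp (- (cmod z)\<^sup>2) / pi) * g z \<le> g z" by simp
qed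

definition gaussian_abs_moment :: ennreal where
  "gaussian_abs_moment = (\<integral>\<^sup>+z. ennreal (cmod z) \<partial>std_complex_gaussian)"

lemma gaussian_abs_moment_finite: "gaussian_abs_moment < \<infinity>"
proof -
  define h where "h = (\<lambda>(b::complex) (x::real). exp (- (x\<^sup>2 / 2)))"
  have "gaussian_abs_moment = (\<integral>\<^sup>+z. ennreal (exp (- (cmod z)\<^sup>2) / pi) * ennreal (cmod z) \<partial>lborel)"
    unfolding gaussian_abs_moment_def by (rule nn_integral_std_complex_gaussian) auto
  also have "\<dots> \<le> (\<integral>\<^sup>+z. (\<Prod>b\<in>Basis. ennreal (h b (z \<bullet> b))) \<partial>lborel)"
  proof (rule nn_integral_mono)
    fix z :: complex
    \<comment> \<open>This leads to \<open>cmod z \<le> exp ((cmod z)\<^sup>2 / 2)\<close>: half of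
      the Gaussian exponent pays for the factor \<open>cmod z\<close>, and the other half splits
      over real and imaginary part.\<close>
    have "2 * cmod z \<le> (cmod z)\<^sup>2 + 1"
      using zero_le_power2[of "cmod z - 1"] by (simp add: power2_eq_square algebra_simps)
    hence "cmod z \<le> 1 + (cmod z)\<^sup>2 / 2" by simp
    also have "\<dots> \<le> exp ((cmod z)\<^sup>2 / 2)" by (rule exp_ge_add_one_self)
    finally have "exp (- (cmod z)\<^sup>2) / pi * cmod z \<le> exp (- (cmod z)\<^sup>2) / 1 * exp ((cmod z)\<^sup>2 / 2)"
      using pi_gt3 by (intro mult_mono divide_left_mono) auto
    also have "\<dots> = exp (- ((Re z)\<^sup>2 / 2)) * exp (- ((Im z)\<^sup>2 / 2))"
      unfolding cmod_power2 by (simp add: field_simps flip: exp_add)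
    finally show "ennreal (exp (- (cmod z)\<^sup>2) / pi) * ennreal (cmod z) \<le> (\<Prod>b\<in>Basis. ennreal (h b (z \<bullet> b)))"
      by (simp add: Basis_complex_def h_def inner_complex_def ennreal_leI flip: ennreal_mult)
  qed
  also have "\<dots> = (\<Prod>b\<in>(Basis::complex set). (\<integral>\<^sup>+x. ennreal (h b x) \<partial>lborel))"
    by (rule nn_integral_lborel_prod) (auto simp: h_def)
  also have "\<dots> < \<infinity>"
  proof -
    have "integrable lborel (\<lambda>x. sqrt (2 * pi) * std_normal_density x)" by simp
    hence "integrable lborel (\<lambda>x::real. exp (- (x\<^sup>2 / 2)))"
      by (simp add: std_normal_density_def)
    hence "(\<integral>\<^sup>+x. ennreal (h b x) \<partial>lborel) < \<infinity>" for b
      by (simp add: h_def integrable_iff_bounded)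
    thus ?thesis by (simp add: Basis_complex_def ennreal_mult_less_top)
  qed
  finally show ?thesis .
qed

text \<open>Anti-concentration, uniform in the shift w: since c is unimodular, dividing by it
  changes no modulus and leaves a mere translation of y.\<close>

lemma nn_integral_neg_ln_gaussian_le:
  assumes "cmod c = 1"
  shows "(\<integral>\<^sup>+y. neg_ln_cmod (c * y + w) \<partial>std_complex_gaussian) \<le> log_mass"
proof -
  have [simp]: "c \<noteq> 0" using assms by auto
  have "neg_ln_cmod (c * y + w) = neg_ln_cmod (w / c + y)" for y
  proof -
    have "c * y + w = c * (w / c + y)" by (simp add: field_simps)
    thus ?thesis using assms by (simp add: neg_ln_cmod_def norm_mult)
  qed
  hence "(\<integral>\<^sup>+y. neg_ln_cmod (c * y + w) \<partial>std_complex_gaussian) = (\<integral>\<^sup>+y. neg_ln_cmod (w / c + y) \<partial>std_complex_gaussian)"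
    by simp
  also have "\<dots> \<le> (\<integral>\<^sup>+y. neg_ln_cmod (w / c + y) \<partial>lborel)"
    by (rule nn_integral_std_complex_gaussian_le) auto
  finally show ?thesis by (simp add: nn_integral_neg_ln_translate)
qed

locale iid_gaussians = prob_space M for M :: "'a measure" +
  fixes \<xi> :: "nat \<Rightarrow> 'a \<Rightarrow> complex"
  assumes indep: "indep_vars (\<lambda>_. borel) \<xi> UNIV"
    and law: "\<And>k. distr M borel (\<xi> k) = std_complex_gaussian"
begin

lemma rv [measurable]: "\<xi> k \<in> borel_measurable M"
  using indep by (auto simp: indep_vars_def)

lemma prob_space_std_complex_gaussian: "prob_space std_complex_gaussian"
  unfolding law[of 0, symmetric] by (rule prob_space_distr) auto

text \<open>Independence makes the joint law a product measure. Integrating coordinate i innermost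
  leaves the remaining sum as a fixed shift w, and the one-variable bound does not see w.\<close>

lemma nn_integral_neg_ln_sum_le:
  assumes "finite I" "i \<in> I" "cmod (c i) = 1"
  shows "(\<integral>\<^sup>+\<omega>. neg_ln_cmod (\<Sum>j\<in>I. c j * \<xi> j \<omega>) \<partial>M) \<le> log_mass"
proof -
  interpret G: prob_space std_complex_gaussian by (rule prob_space_std_complex_gaussian)
  interpret P: product_prob_space "\<lambda>_::nat. std_complex_gaussian" UNIV by standard
  define J where "J = I - {i}"
  have J: "finite J" "i \<notin> J" "I = insert i J" using assms by (auto simp: J_def)
  have "indep_vars (\<lambda>_. borel) \<xi> I" using indep by (rule indep_vars_subset) auto
  hence distr_eq: "distr M (\<Pi>\<^sub>M i\<in>I. borel) (\<lambda>x. \<lambda>i\<in>I. \<xi> i x) = (\<Pi>\<^sub>M i\<in>I. std_complex_gaussian)"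
    using assms by (subst (asm) indep_vars_iff_distr_eq_PiM') (auto simp: law)
  have sets_eq: "sets (\<Pi>\<^sub>M i\<in>I. std_complex_gaussian) = sets (\<Pi>\<^sub>M i\<in>I. borel)"
    by (intro sets_PiM_cong refl sets_std_complex_gaussian)
  have meas: "(\<lambda>x. ennreal (neg_ln_cmod (\<Sum>j\<in>I. c j * x j))) \<in> borel_measurable (\<Pi>\<^sub>M i\<in>I. borel)"
    by measurable
  hence meas': "(\<lambda>x. ennreal (neg_ln_cmod (\<Sum>j\<in>I. c j * x j))) \<in> borel_measurable (\<Pi>\<^sub>M i\<in>I. std_complex_gaussian)"
    by (simp add: measurable_cong_sets[OF sets_eq refl])
  have "(\<integral>\<^sup>+\<omega>. neg_ln_cmod (\<Sum>j\<in>I. c j * \<xi> j \<omega>) \<partial>M)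
      = (\<integral>\<^sup>+\<omega>. neg_ln_cmod (\<Sum>j\<in>I. c j * (\<lambda>i\<in>I. \<xi> i \<omega>) j) \<partial>M)"
    by (intro nn_integral_cong arg_cong[where f="\<lambda>x. ennreal (neg_ln_cmod x)"] sum.cong) auto
  also have "\<dots> = (\<integral>\<^sup>+x. neg_ln_cmod (\<Sum>j\<in>I. c j * x j) \<partial>distr M (\<Pi>\<^sub>M i\<in>I. borel) (\<lambda>x. \<lambda>i\<in>I. \<xi> i x))"
  proof (rule nn_integral_distr[symmetric])
    show "(\<lambda>x. \<lambda>i\<in>I. \<xi> i x) \<in> measurable M (\<Pi>\<^sub>M i\<in>I. borel)"
      by (intro measurable_restrict) auto
  qed (use meas in simp)
  also have "\<dots> = (\<integral>\<^sup>+x. neg_ln_cmod (\<Sum>j\<in>insert i J. c j * x j) \<partial>(\<Pi>\<^sub>M i\<in>insert i J. std_complex_gaussian))"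
    by (simp only: distr_eq flip: J(3))
  also have "\<dots> = (\<integral>\<^sup>+x. \<integral>\<^sup>+y. neg_ln_cmod (\<Sum>j\<in>insert i J. c j * (x(i := y)) j) \<partial>std_complex_gaussian
                      \<partial>(\<Pi>\<^sub>M i\<in>J. std_complex_gaussian))"
    using meas' J by (subst P.product_nn_integral_insert) auto
  also have "\<dots> = (\<integral>\<^sup>+x. \<integral>\<^sup>+y. neg_ln_cmod (c i * y + (\<Sum>j\<in>J. c j * x j)) \<partial>std_complex_gaussian
                      \<partial>(\<Pi>\<^sub>M i\<in>J. std_complex_gaussian))"
  proof -
    have "(\<Sum>j\<in>insert i J. c j * (x(i := y)) j) = c i * y + (\<Sum>j\<in>J. c j * x j)" for x y
    proof -
      have "(\<Sum>j\<in>J. c j * (x(i := y)) j) = (\<Sum>j\<in>J. c j * x j)"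
        using J by (intro sum.cong) auto
      thus ?thesis using J by simp
    qed
    thus ?thesis by simp
  qed
  also have "\<dots> \<le> (\<integral>\<^sup>+x. log_mass \<partial>(\<Pi>\<^sub>M i\<in>J. std_complex_gaussian))"
    using assms by (intro nn_integral_mono nn_integral_neg_ln_gaussian_le)
  also have "\<dots> = log_mass"
  proof -
    interpret PJ: prob_space "\<Pi>\<^sub>M i\<in>J. std_complex_gaussian" by (rule prob_space_PiM) (rule prob_space_std_complex_gaussian)
    show ?thesis by (simp add: PJ.emeasure_space_1)
  qed
  finally show ?thesis .
qed

lemma nn_integral_norm: "(\<integral>\<^sup>+\<omega>. ennreal (cmod (\<xi> j \<omega>)) \<partial>M) = gaussian_abs_moment"
  unfolding gaussian_abs_moment_def law[of j, symmetric] by (subst nn_integral_distr) auto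

text \<open>The upper bound uses \<open>ln s \<le> s / n + ln n\<close>; the lower bound conditions on all coefficients
  but a largest one, whose law has a bounded density.\<close>

lemma nn_integral_abs_ln_sum_le:
  assumes "finite I" "i \<in> I" "cmod (c i) = 1" "\<And>j. j \<in> I \<Longrightarrow> cmod (c j) \<le> 1"
  shows "(\<integral>\<^sup>+\<omega>. ennreal \<bar>ln (cmod (\<Sum>j\<in>I. c j * \<xi> j \<omega>))\<bar> \<partial>M)
           \<le> log_mass + gaussian_abs_moment + ennreal (ln (card I))"
proof -
  define n where "n = real (card I)"
  have n: "n \<ge> 1" using assms by (auto simp: n_def Suc_le_eq card_gt_0_iff)
  have "(\<integral>\<^sup>+\<omega>. ennreal \<bar>ln (cmod (\<Sum>j\<in>I. c j * \<xi> j \<omega>))\<bar> \<partial>M)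
     \<le> (\<integral>\<^sup>+\<omega>. ennreal (neg_ln_cmod (\<Sum>j\<in>I. c j * \<xi> j \<omega>))
           + (ennreal (1 / n) * (\<Sum>j\<in>I. ennreal (cmod (\<xi> j \<omega>))) + ennreal (ln n)) \<partial>M)"
  proof (rule nn_integral_mono)
    fix \<omega>
    define s where "s = cmod (\<Sum>j\<in>I. c j * \<xi> j \<omega>)"
    have "s \<le> (\<Sum>j\<in>I. cmod (c j * \<xi> j \<omega>))" unfolding s_def by (rule norm_sum)
    also have "\<dots> \<le> (\<Sum>j\<in>I. 1 * cmod (\<xi> j \<omega>))"
      unfolding norm_mult using assms by (intro sum_mono mult_right_mono) auto
    finally have s: "s \<le> (\<Sum>j\<in>I. cmod (\<xi> j \<omega>))" by simp
    have "ln s \<le> 1 / n * s + ln n"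
    proof (cases "s = 0")
      case False
      hence "s > 0" by (simp add: s_def)
      hence "ln (s / n) \<le> s / n - 1" using n by (intro ln_le_minus_one) auto
      thus ?thesis using n \<open>s > 0\<close> by (simp add: ln_div)
    qed (use n in auto)
    also have "\<dots> \<le> 1 / n * (\<Sum>j\<in>I. cmod (\<xi> j \<omega>)) + ln n"
      using s n by (intro add_right_mono mult_left_mono) auto
    finally have up: "ln s \<le> 1 / n * (\<Sum>j\<in>I. cmod (\<xi> j \<omega>)) + ln n" .
    have nn: "0 \<le> 1 / n * (\<Sum>j\<in>I. cmod (\<xi> j \<omega>))" "0 \<le> ln n" using n by (auto intro!: sum_nonneg divide_nonneg_nonneg)
    have "\<bar>ln s\<bar> \<le> neg_ln_cmod (\<Sum>j\<in>I. c j * \<xi> j \<omega>) + (1 / n * (\<Sum>j\<in>I. cmod (\<xi> j \<omega>)) + ln n)"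
      using up nn unfolding neg_ln_cmod_def s_def[symmetric] by linarith
    hence "ennreal \<bar>ln s\<bar> \<le> ennreal (neg_ln_cmod (\<Sum>j\<in>I. c j * \<xi> j \<omega>) + (1 / n * (\<Sum>j\<in>I. cmod (\<xi> j \<omega>)) + ln n))"
      by (rule ennreal_leI)
    also have "\<dots> = ennreal (neg_ln_cmod (\<Sum>j\<in>I. c j * \<xi> j \<omega>))
           + (ennreal (1 / n) * (\<Sum>j\<in>I. ennreal (cmod (\<xi> j \<omega>))) + ennreal (ln n))"
      using nn n by (simp add: ennreal_mult[symmetric] sum_nonneg del: ennreal_plus add: ennreal_plus[symmetric])
    finally show "ennreal \<bar>ln (cmod (\<Sum>j\<in>I. c j * \<xi> j \<omega>))\<bar> \<le> \<dots>" by (simp add: s_def)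
  qed
  also have "\<dots> = (\<integral>\<^sup>+\<omega>. neg_ln_cmod (\<Sum>j\<in>I. c j * \<xi> j \<omega>) \<partial>M)
       + (ennreal (1 / n) * (\<Sum>j\<in>I. \<integral>\<^sup>+\<omega>. ennreal (cmod (\<xi> j \<omega>)) \<partial>M) + ennreal (ln n))"
    by (simp add: nn_integral_add nn_integral_cmult nn_integral_sum emeasure_space_1 del: sum_ennreal)
  also have "\<dots> \<le> log_mass + (ennreal (1 / n) * (\<Sum>j\<in>I. gaussian_abs_moment) + ennreal (ln n))"
    using nn_integral_neg_ln_sum_le[of I i c, OF assms(1-3)] by (simp add: nn_integral_norm add_right_mono)
  \<comment> \<open>The factor 1 / n balances the number of first moments, so \<open>ln n\<close>
    remains as the only growing term.\<close>
  also have "ennreal (1 / n) * (\<Sum>j\<in>I. gaussian_abs_moment) = gaussian_abs_moment"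
  proof -
    have "ennreal (1 / n) * (\<Sum>j\<in>I. gaussian_abs_moment) = ennreal (1 / n) * ennreal n * gaussian_abs_moment"
      by (simp add: n_def ennreal_of_nat_eq_real_of_nat mult.assoc)
    also have "ennreal (1 / n) * ennreal n = 1" using n by (simp flip: ennreal_mult)
    finally show ?thesis by simp
  qed
  finally show ?thesis by (simp add: n_def add.assoc)
qed

end

text \<open>Unfolding the recursion, \<open>w j * r ^ j\<close> is \<open>w N\<close> times the
  product of r over i \<le> j and of \<open>\<rho> i\<close> over j < i \<le> N. Each such product
  is at most the product of the maxima; as \<rho> is increasing it crosses r only once, so some j
  takes the larger factor at every index.\<close>

lemma maximal_term:
  fixes w \<rho> :: "nat \<Rightarrow> real"
  assumes pos: "\<And>j. w j > 0" and rec: "\<And>j. w j = w (Suc j) * \<rho> (Suc j)" and mono: "mono \<rho>" and r: "r > 0"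
  shows "j \<le> N \<Longrightarrow> w j * r ^ j \<le> w N * (\<Prod>i=1..N. max r (\<rho> i))"
    and "\<exists>j\<le>N. w j * r ^ j = w N * (\<Prod>i=1..N. max r (\<rho> i))"
proof -
  have step: "w (Suc N) * (\<Prod>i=1..Suc N. max r (\<rho> i)) = w (Suc N) * max r (\<rho> (Suc N)) * (\<Prod>i=1..N. max r (\<rho> i))" for N
    by (simp add: prod.nat_ivl_Suc')
  show "\<exists>j\<le>N. w j * r ^ j = w N * (\<Prod>i=1..N. max r (\<rho> i))"
  proof (induction N)
    case (Suc N)
    show ?case
    proof (cases "r \<le> \<rho> (Suc N)")
      case True
      hence "w (Suc N) * (\<Prod>i=1..Suc N. max r (\<rho> i)) = w N * (\<Prod>i=1..N. max r (\<rho> i))"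
        unfolding step rec[of N] by simp
      with Suc.IH show ?thesis by (metis le_SucI)
    next
      case False
      \<comment> \<open>Now \<open>\<rho> (Suc N) < r\<close>, so by monotonicity all ratios lie
        below r and the last term is the maximal one.\<close>
      have "max r (\<rho> i) = r" if "i \<in> {1..Suc N}" for i
        using monoD[OF mono, of i "Suc N"] that False by auto
      hence "(\<Prod>i=1..Suc N. max r (\<rho> i)) = (\<Prod>i=1..Suc N. r)" by (intro prod.cong) auto
      thus ?thesis by (intro exI[of _ "Suc N"]) simp
    qed
  qed auto
  show "j \<le> N \<Longrightarrow> w j * r ^ j \<le> w N * (\<Prod>i=1..N. max r (\<rho> i))"
  proof (induction N)
    case (Suc N)
    show ?case
    proof (cases "j = Suc N")
      case True
      have "(\<Prod>i=1..Suc N. r) \<le> (\<Prod>i=1..Suc N. max r (\<rho> i))" using r by (intro prod_mono) auto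
      hence "r ^ Suc N \<le> (\<Prod>i=1..Suc N. max r (\<rho> i))" by simp
      thus ?thesis unfolding True using pos[of "Suc N"] by (intro mult_left_mono) auto
    next
      case False
      hence "w j * r ^ j \<le> w N * (\<Prod>i=1..N. max r (\<rho> i))" using Suc by auto
      also have "w N \<le> w (Suc N) * max r (\<rho> (Suc N))"
        unfolding rec[of N] using pos[of "Suc N"] by (intro mult_left_mono) auto
      hence "w N * (\<Prod>i=1..N. max r (\<rho> i)) \<le> w (Suc N) * max r (\<rho> (Suc N)) * (\<Prod>i=1..N. max r (\<rho> i))"
        using r by (intro mult_right_mono prod_nonneg) auto
      finally show ?thesis unfolding step .
    qed
  qed auto
qed
section \<open>The limiting potential\<close>

abbreviation unif01_sq :: "(real \<times> real) measure" where
  "unif01_sq \<equiv> unif01 \<Otimes>\<^sub>M unif01"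

interpretation unif01_sq: pair_prob_space unif01 unif01
  by standard

interpretation unif01_sq_lborel: pair_sigma_finite unif01_sq "lborel :: complex measure"
  by standard

text \<open>The law of \<open>g(U) exp(2 pi i V)\<close> with U, V independent and uniform on
  [0, 1]. Giving the radius as a function of a uniform variable lets averages over coefficient
  indices converge to integrals over x.\<close>

definition radial_law :: "(real \<Rightarrow> real) \<Rightarrow> complex measure" where
  "radial_law g = distr unif01_sq borel (\<lambda>(x, y). of_real (g x) * ecis y)"

lemma AE_unif01: "AE x in unif01. x \<in> {0..1}"
  by (rule AE_uniform_measureI) auto

lemma AE_unif01_sq_fst:
  assumes "AE x in unif01. P x" "Measurable.pred borel P"
  shows "AE p in unif01_sq. P (fst p)"
proof -
  have "AE x in unif01. AE y in unif01. P (fst (x, y))"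
    using assms(1) by eventually_elim auto
  moreover have "Measurable.pred unif01_sq (\<lambda>p. P (fst p))"
    using assms(2) by measurable
  ultimately show ?thesis
    by (subst unif01_sq.AE_pair_iff[symmetric]) (auto simp: pred_def)
qed

lemma borel_measurable_log_pot [measurable]:
  assumes [measurable]: "\<psi> \<in> borel_measurable borel"
  shows "log_pot \<psi> \<in> borel_measurable borel"
  unfolding log_pot_def by measurable

text \<open>Fubini brings the law inside the integral over z, and the angle is then averaged by the
  circle formula. By \<open>gne\<close> no radius has positive probability, so the case
  \<open>g x = cmod z\<close> excluded in that formula is negligible for every z.\<close>

lemma (in compact_bounded) integral_log_pot_radial_law:
  assumes g [measurable]: "g \<in> borel_measurable borel"
    and gb: "\<And>x. x \<in> {0..1} \<Longrightarrow> 0 \<le> g x \<and> g x \<le> G"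
    and gne: "\<And>s. AE x in unif01. g x \<noteq> s"
  shows "(\<integral>a. log_pot \<psi> a \<partial>radial_law g) = (\<integral>z. \<psi> z * (\<integral>x. ln (max (cmod z) (g x)) \<partial>unif01) \<partial>lborel)"
proof -
  define pt where "pt = (\<lambda>p. of_real (g (fst p)) * ecis (snd p))"
  have [measurable]: "pt \<in> borel_measurable unif01_sq" unfolding pt_def by measurable
  define F where "F = (\<lambda>p z. \<psi> z * ln (cmod (z - pt p)))"
  have F_meas: "(\<lambda>(p, z). F p z) \<in> borel_measurable (unif01_sq \<Otimes>\<^sub>M lborel)"
    unfolding F_def by measurable
  define C where "C = ennreal b * (log_mass + ennreal (B + G) * emeasure lborel (cball 0 B :: complex set))"
  have int: "integrable (unif01_sq \<Otimes>\<^sub>M lborel) (\<lambda>(p, z). F p z)"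
  proof (rule integrableI_bounded)
    have "(\<integral>\<^sup>+q. ennreal (norm (case q of (p, z) \<Rightarrow> F p z)) \<partial>(unif01_sq \<Otimes>\<^sub>M lborel))
        = (\<integral>\<^sup>+p. \<integral>\<^sup>+z. ennreal \<bar>F p z\<bar> \<partial>lborel \<partial>unif01_sq)"
      using F_meas by (subst lborel.nn_integral_fst[symmetric]) auto
    also have "\<dots> \<le> (\<integral>\<^sup>+p. C \<partial>unif01_sq)"
    proof (rule nn_integral_mono_AE)
      have "AE p in unif01_sq. fst p \<in> {0..1}"
        using AE_unif01 by (rule AE_unif01_sq_fst) auto
      thus "AE p in unif01_sq. (\<integral>\<^sup>+z. ennreal \<bar>F p z\<bar> \<partial>lborel) \<le> C"
      proof eventually_elim
        case (elim p)
        show ?case unfolding F_def C_def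
          by (rule nn_integral_ln_le) (use gb[OF elim] in \<open>auto simp: pt_def norm_mult\<close>)
      qed
    qed
    also have "\<dots> < \<infinity>"
      using nn_integral_ln_bound_finite[of G] by (simp add: unif01_sq.P.emeasure_space_1 C_def)
    finally show "(\<integral>\<^sup>+q. ennreal (norm (case q of (p, z) \<Rightarrow> F p z)) \<partial>(unif01_sq \<Otimes>\<^sub>M lborel)) < \<infinity>" .
  qed (rule F_meas)
  have "(\<integral>a. log_pot \<psi> a \<partial>radial_law g) = (\<integral>p. log_pot \<psi> (pt p) \<partial>unif01_sq)"
    unfolding radial_law_def pt_def by (subst integral_distr) (auto simp: case_prod_unfold)
  also have "\<dots> = (\<integral>p. \<integral>z. F p z \<partial>lborel \<partial>unif01_sq)"
    by (simp add: log_pot_def F_def)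
  also have "\<dots> = (\<integral>z. \<integral>p. F p z \<partial>unif01_sq \<partial>lborel)"
    using unif01_sq_lborel.Fubini_integral[OF int] by simp
  also have "\<dots> = (\<integral>z. \<psi> z * (\<integral>x. ln (max (cmod z) (g x)) \<partial>unif01) \<partial>lborel)"
  proof (rule integral_cong_AE)
    show "(\<lambda>z. \<integral>p. F p z \<partial>unif01_sq) \<in> borel_measurable lborel"
      unfolding F_def by measurable
    have "AE z in lborel. integrable unif01_sq (\<lambda>p. F p z)"
      using unif01_sq_lborel.AE_integrable_snd[OF int] .
    thus "AE z in lborel. (\<integral>p. F p z \<partial>unif01_sq) = \<psi> z * (\<integral>x. ln (max (cmod z) (g x)) \<partial>unif01)"
    proof eventually_elim
      case (elim z)
      have "(\<integral>p. F p z \<partial>unif01_sq) = (\<integral>x. \<integral>y. F (x, y) z \<partial>unif01 \<partial>unif01)"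
        using unif01_sq.integral_fst'[OF elim] by simp
      also have "\<dots> = (\<integral>x. \<psi> z * ln (max (cmod z) (g x)) \<partial>unif01)"
      proof (rule integral_cong_AE)
        show "AE x in unif01. (\<integral>y. F (x, y) z \<partial>unif01) = \<psi> z * ln (max (cmod z) (g x))"
          using gne[of "cmod z"] AE_unif01
        proof eventually_elim
          case (elim x)
          have "cmod (z - of_real (g x) * ecis y) = cmod (-z + of_real (g x) * ecis y)" for y
            by (metis minus_diff_eq norm_minus_cancel uminus_add_conv_diff)
          thus ?case using circle_average_ln(2)[of "g x" "-z"] gb[of x] elim
            by (simp add: F_def pt_def max.commute)
        qed
      qed (unfold F_def pt_def, measurable)
      finally show ?case by simp
    qed
  qed measurable
  finally show ?thesis .
qed

lemma abs_ln_max_le: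
  assumes "0 < s" "0 \<le> \<rho>" "\<rho> \<le> G" "1 \<le> (G::real)"
  shows "\<bar>ln (max s \<rho>)\<bar> \<le> \<bar>ln s\<bar> + ln G"
proof (cases "s \<le> \<rho>")
  case True
  have "ln s \<le> ln \<rho>" using True assms by (intro ln_mono) auto
  moreover have "ln \<rho> \<le> ln G" using True assms by (intro ln_mono) auto
  moreover have "0 \<le> ln G" using assms by auto
  ultimately show ?thesis using True by (simp add: max_def)
next
  case False
  have "0 \<le> ln G" using assms by auto
  with False show ?thesis by (simp add: max_def)
qed

text \<open>Turns an average over j into the integral of a step function, so that dominated
  convergence can give its limit. The value \<open>\<phi> j\<close> is taken on
  \<open>((j - 1) / N, j / N]\<close>; the point 0, where the ceiling is 0, is a null set.\<close>

lemma integral_unif01_step: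
  fixes \<phi> :: "nat \<Rightarrow> real"
  assumes N: "N > 0"
  shows "(\<integral>x. \<phi> (nat \<lceil>real N * x\<rceil>) \<partial>unif01) = (\<Sum>j=1..N. \<phi> j) / N"
proof -
  have "(\<integral>x. \<phi> (nat \<lceil>real N * x\<rceil>) \<partial>unif01)
      = (\<integral>x. (\<Sum>j=1..N. \<phi> j * indicator {(real j - 1) / N<..real j / N} x) \<partial>unif01)"
  proof (rule integral_cong_AE)
    show "AE x in unif01. \<phi> (nat \<lceil>real N * x\<rceil>) = (\<Sum>j=1..N. \<phi> j * indicator {(real j - 1) / N<..real j / N} x)"
      using AE_unif01 AE_unif01_neq[of 0]
    proof eventually_elim
      case (elim x)
      define k where "k = nat \<lceil>real N * x\<rceil>"
      have Nx: "0 < real N * x" "real N * x \<le> N" using elim N by (auto simp: mult_le_cancel_left1)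
      have iff: "x \<in> {(real j - 1) / N<..real j / N} \<longleftrightarrow> j = k" if "j \<in> {1..N}" for j
      proof -
        have "x \<in> {(real j - 1) / N<..real j / N} \<longleftrightarrow> real j - 1 < real N * x \<and> real N * x \<le> real j"
          using N by (auto simp: field_simps)
        also have "\<dots> \<longleftrightarrow> \<lceil>real N * x\<rceil> = int j" by (auto simp: ceiling_eq_iff)
        also have "\<dots> \<longleftrightarrow> j = k" using Nx unfolding k_def by linarith
        finally show ?thesis .
      qed
      have k: "k \<in> {1..N}" using Nx unfolding k_def by (auto simp: Suc_le_eq ceiling_le_iff nat_le_iff)
      have "(\<Sum>j=1..N. \<phi> j * indicator {(real j - 1) / N<..real j / N} x) = (\<Sum>j=1..N. if j = k then \<phi> j else 0)"
        using iff by (intro sum.cong refl) (auto simp: indicator_def)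
      also have "\<dots> = \<phi> k" using k by simp
      finally show ?case by (simp add: k_def)
    qed
  qed measurable
  also have "\<dots> = (\<Sum>j=1..N. \<phi> j * measure unif01 {(real j - 1) / N<..real j / N})"
    by (subst Bochner_Integration.integral_sum) (auto intro!: integrable_mult_right simp: unif01.emeasure_eq_measure)
  also have "\<dots> = (\<Sum>j=1..N. \<phi> j * (1 / N))"
  proof (intro sum.cong refl)
    fix j assume j: "j \<in> {1..N}"
    have "{0..1} \<inter> {(real j - 1) / N<..real j / N} = {(real j - 1) / N<..real j / N}"
    proof -
      have "0 \<le> (real j - 1) / N" "real j / N \<le> 1" using j N by auto
      thus ?thesis by auto
    qed
    moreover have "(real j - 1) / N \<le> real j / N" using N by (simp add: divide_right_mono)
    ultimately have "measure unif01 {(real j - 1) / N<..real j / N} = 1 / N"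
      by (simp add: diff_divide_distrib)
    thus "\<phi> j * measure unif01 {(real j - 1) / N<..real j / N} = \<phi> j * (1 / N)" by simp
  qed
  finally show ?thesis by (simp add: sum_divide_distrib)
qed

text \<open>The quantile function of the modulus under the limit law: the inverse of
  \<open>r \<mapsto> r t (1 - t) / (1 - r (1 - t)\<^sup>2)\<close>. It is the limit of the ratios \<open>coeff_ratio\<close> of consecutive
  coefficient sizes of the \<open>m\<close>-th derivative, where \<open>m \<approx> t n\<close> and \<open>j \<approx> (1 - t) n x\<close>.\<close>

definition limit_radius :: "real \<Rightarrow> real \<Rightarrow> real" where
  "limit_radius t x = x / ((1 - t) * (t + (1 - t) * x))"

definition coeff_ratio :: "real \<Rightarrow> nat \<Rightarrow> nat \<Rightarrow> real" where
  "coeff_ratio t m j = real j / ((1 - t)\<^sup>2 * (real j + real m))"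

lemma real_nat_ceiling_bounds:
  assumes "0 \<le> x"
  shows "x \<le> real (nat \<lceil>x\<rceil>)" "real (nat \<lceil>x\<rceil>) \<le> x + 1"
  using assms by (auto simp: real_nat_ceiling_ge)

section \<open>Asymptotics of the coefficient ratios\<close>

locale derivative_fraction =
  fixes t :: real
  assumes t: "0 < t" "t < 1"
begin

lemma limit_radius_bounds:
  assumes "x \<in> {0..1}"
  shows "0 \<le> limit_radius t x \<and> limit_radius t x \<le> 1 / (1 - t)"
proof -
  have "x \<le> t + (1 - t) * x"
  proof -
    have "t * x \<le> t * 1" using t assms by (intro mult_left_mono) auto
    thus ?thesis by (simp add: algebra_simps)
  qed
  moreover have "0 < t + (1 - t) * x" using t assms by (intro add_pos_nonneg) auto
  ultimately show ?thesis using t assms unfolding limit_radius_def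
    by (auto simp: divide_simps)
qed

text \<open>Cleared of denominators, the condition is linear in x and valid whatever the sign of
  \<open>1 - s * (1 - t)\<^sup>2\<close>; the distribution function of the modulus is read off from
  it.\<close>

lemma limit_radius_le_iff:
  assumes "x \<in> {0..1}"
  shows "limit_radius t x \<le> s \<longleftrightarrow> x * (1 - s * (1 - t)\<^sup>2) \<le> s * t * (1 - t)"
proof -
  have "0 < t + (1 - t) * x" using t assms by (intro add_pos_nonneg) auto
  hence "0 < (1 - t) * (t + (1 - t) * x)" using t by simp
  thus ?thesis unfolding limit_radius_def
    by (simp add: pos_divide_le_eq) (simp add: power2_eq_square algebra_simps)
qed

text \<open>As a fractional linear function, \<open>limit_radius t\<close> takes the value s at most
  once in the unit interval, namely at the solution of a linear equation.\<close>

lemma AE_limit_radius_neq: "AE x in unif01. limit_radius t x \<noteq> s"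
  using AE_unif01 AE_unif01_neq[of "s * t * (1 - t) / (1 - s * (1 - t)\<^sup>2)"]
proof eventually_elim
  case (elim x)
  show ?case
  proof
    assume "limit_radius t x = s"
    moreover have "0 < t + (1 - t) * x" using t elim by (intro add_pos_nonneg) auto
    hence "(1 - t) * (t + (1 - t) * x) \<noteq> 0" using t by simp
    ultimately have "x = s * ((1 - t) * (t + (1 - t) * x))"
      unfolding limit_radius_def by (metis nonzero_divide_eq_eq)
    hence *: "x * (1 - s * (1 - t)\<^sup>2) = s * t * (1 - t)"
      by (simp add: power2_eq_square algebra_simps)
    show False
    \<comment> \<open>When this coefficient vanishes the equation has no solution: it would force s
      = 0, for which the coefficient is 1.\<close>
    proof (cases "1 - s * (1 - t)\<^sup>2 = 0")
      case True
      with * have "s = 0" using t by auto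
      with True show False by simp
    next
      case False
      with * elim show False by (simp add: eq_divide_eq)
    qed
  qed
qed

lemma borel_measurable_limit_radius [measurable]: "limit_radius t \<in> borel_measurable borel"
  unfolding limit_radius_def by measurable

lemma coeff_ratio_bounds: "0 \<le> coeff_ratio t m j" "coeff_ratio t m j \<le> 1 / (1 - t)\<^sup>2"
proof -
  show "0 \<le> coeff_ratio t m j" unfolding coeff_ratio_def by auto
  show "coeff_ratio t m j \<le> 1 / (1 - t)\<^sup>2"
  proof (cases "j = 0")
    case False
    have "coeff_ratio t m j \<le> (real j + real m) / ((1 - t)\<^sup>2 * (real j + real m))"
      unfolding coeff_ratio_def by (intro divide_right_mono) auto
    also have "\<dots> = 1 / (1 - t)\<^sup>2" using False by simp
    finally show ?thesis .
  qed (auto simp: coeff_ratio_def)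
qed

abbreviation "dord n \<equiv> nat \<lceil>t * real n\<rceil>"

lemma dord_limit: "(\<lambda>n. real (dord n) / real n) \<longlonglongrightarrow> t"
proof (rule tendsto_sandwich[where f = "\<lambda>_. t" and h = "\<lambda>n. t + 1 / real n"])
  show "(\<lambda>n. t + 1 / real n) \<longlonglongrightarrow> t" by real_asymp
  show "(\<lambda>n. t) \<longlonglongrightarrow> t" by simp
  show "\<forall>\<^sub>F n in sequentially. t \<le> real (dord n) / real n"
    using eventually_gt_at_top[of 0]
  proof eventually_elim
    case (elim n)
    thus ?case using real_nat_ceiling_bounds(1)[of "t * real n"] t by (simp add: le_divide_eq)
  qed
  show "\<forall>\<^sub>F n in sequentially. real (dord n) / real n \<le> t + 1 / real n"
    using eventually_gt_at_top[of 0]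
  proof eventually_elim
    case (elim n)
    thus ?case using real_nat_ceiling_bounds(2)[of "t * real n"] t by (simp add: field_simps)
  qed
qed

lemma dord_le: "dord n \<le> n"
proof -
  have "t * real n \<le> 1 * real n" using t by (intro mult_right_mono) auto
  thus ?thesis by (simp add: nat_le_iff ceiling_le_iff)
qed

lemma degree_limit: "(\<lambda>n. real (n - dord n) / real n) \<longlonglongrightarrow> 1 - t"
proof -
  have "(\<lambda>n. 1 - real (dord n) / real n) \<longlonglongrightarrow> 1 - t"
    by (intro tendsto_diff dord_limit tendsto_const)
  moreover have "\<forall>\<^sub>F n in sequentially. 1 - real (dord n) / real n = real (n - dord n) / real n"
    using eventually_gt_at_top[of 0] by eventually_elim (use dord_le in \<open>auto simp: of_nat_diff diff_divide_distrib\<close>)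
  ultimately show ?thesis using tendsto_cong by force
qed

lemma degree_at_top: "filterlim (\<lambda>n. n - dord n) at_top sequentially"
proof -
  have "filterlim (\<lambda>n. real (n - dord n) / real n * real n) at_top sequentially"
    using t by (intro filterlim_tendsto_pos_mult_at_top[OF degree_limit] filterlim_real_sequentially) auto
  moreover have "\<forall>\<^sub>F n in sequentially. real (n - dord n) / real n * real n = real (n - dord n)"
    using eventually_gt_at_top[of 0] by eventually_elim auto
  ultimately have "filterlim (\<lambda>n. real (n - dord n)) at_top sequentially"
    using filterlim_cong[OF refl refl] by force
  thus ?thesis by (simp add: filterlim_sequentially_iff_filterlim_real)
qed

lemma coeff_ratio_limit:
  assumes "0 < x"
  shows "(\<lambda>n. coeff_ratio t (dord n) (nat \<lceil>real (n - dord n) * x\<rceil>)) \<longlonglongrightarrow> limit_radius t x"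
proof -
  define j where "j = (\<lambda>n. nat \<lceil>real (n - dord n) * x\<rceil>)"
  have j: "(\<lambda>n. real (j n) / real n) \<longlonglongrightarrow> (1 - t) * x"
  proof (rule tendsto_sandwich)
    show "(\<lambda>n. real (n - dord n) / real n * x) \<longlonglongrightarrow> (1 - t) * x"
      by (intro tendsto_mult degree_limit tendsto_const)
    have "(\<lambda>n. real (n - dord n) / real n * x + 1 / real n) \<longlonglongrightarrow> (1 - t) * x + 0"
      by (intro tendsto_add tendsto_mult degree_limit tendsto_const lim_1_over_n)
    thus "(\<lambda>n. real (n - dord n) / real n * x + 1 / real n) \<longlonglongrightarrow> (1 - t) * x" by simp
    show "\<forall>\<^sub>F n in sequentially. real (n - dord n) / real n * x \<le> real (j n) / real n"
      using eventually_gt_at_top[of 0]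
    proof eventually_elim
      case (elim n)
      thus ?case using real_nat_ceiling_bounds(1)[of "real (n - dord n) * x"] assms
        by (simp add: j_def field_simps)
    qed
    show "\<forall>\<^sub>F n in sequentially. real (j n) / real n \<le> real (n - dord n) / real n * x + 1 / real n"
      using eventually_gt_at_top[of 0]
    proof eventually_elim
      case (elim n)
      thus ?case using real_nat_ceiling_bounds(2)[of "real (n - dord n) * x"] assms
        by (simp add: j_def field_simps)
    qed
  qed
  have "(\<lambda>n. (real (j n) / real n) / ((1 - t)\<^sup>2 * (real (j n) / real n + real (dord n) / real n)))
          \<longlonglongrightarrow> ((1 - t) * x) / ((1 - t)\<^sup>2 * ((1 - t) * x + t))"
  proof (intro tendsto_divide tendsto_mult tendsto_add j dord_limit tendsto_const)
    have "0 < (1 - t) * x + t" using t assms by (intro add_pos_pos) auto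
    thus "(1 - t)\<^sup>2 * ((1 - t) * x + t) \<noteq> 0" using t by auto
  qed
  also have "((1 - t) * x) / ((1 - t)\<^sup>2 * ((1 - t) * x + t)) = limit_radius t x"
    using t by (simp add: limit_radius_def power2_eq_square add.commute)
  finally have lim: "(\<lambda>n. (real (j n) / real n) / ((1 - t)\<^sup>2 * (real (j n) / real n + real (dord n) / real n))) \<longlonglongrightarrow> limit_radius t x" .
  moreover have "\<forall>\<^sub>F n in sequentially. (real (j n) / real n) / ((1 - t)\<^sup>2 * (real (j n) / real n + real (dord n) / real n)) = coeff_ratio t (dord n) (j n)"
    using eventually_gt_at_top[of 0]
  proof eventually_elim
    case (elim n)
    have "(1 - t)\<^sup>2 * (real (j n) / real n + real (dord n) / real n) = ((1 - t)\<^sup>2 * (real (j n) + real (dord n))) / real n"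
      by (simp flip: add_divide_distrib)
    thus ?case using elim unfolding coeff_ratio_def by simp
  qed
  ultimately have "(\<lambda>n. coeff_ratio t (dord n) (j n)) \<longlonglongrightarrow> limit_radius t x"
    using Lim_transform_eventually by fast
  thus ?thesis by (simp add: j_def)
qed

text \<open>The logarithm of the maximal term divided by the degree, without the contribution of the
  top weight, which does not depend on z and integrates to zero against mean-zero densities.\<close>

definition mean_log :: "nat \<Rightarrow> complex \<Rightarrow> real" where
  "mean_log n z = (\<Sum>j=1..n - dord n. ln (max (cmod z) (coeff_ratio t (dord n) j))) / real (n - dord n)"

lemma G_ge_1: "1 \<le> 1 / (1 - t)\<^sup>2"
  using t by (auto simp: power_le_one_iff abs_le_iff)

lemma abs_mean_log_le:
  assumes "z \<noteq> 0"
  shows "\<bar>mean_log n z\<bar> \<le> \<bar>ln (cmod z)\<bar> + ln (1 / (1 - t)\<^sup>2)"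
proof (cases "n - dord n = 0")
  case True
  have "0 \<le> ln (1 / (1 - t)\<^sup>2)" using G_ge_1 by (rule ln_ge_zero)
  thus ?thesis unfolding mean_log_def True by simp
next
  case False
  have "\<bar>\<Sum>j=1..n - dord n. ln (max (cmod z) (coeff_ratio t (dord n) j))\<bar>
      \<le> (\<Sum>j=1..n - dord n. \<bar>ln (max (cmod z) (coeff_ratio t (dord n) j))\<bar>)" by (rule sum_abs)
  also have "\<dots> \<le> (\<Sum>j=1..n - dord n. \<bar>ln (cmod z)\<bar> + ln (1 / (1 - t)\<^sup>2))"
    using assms by (intro sum_mono abs_ln_max_le coeff_ratio_bounds G_ge_1) auto
  finally show ?thesis using False unfolding mean_log_def by (simp add: abs_divide divide_le_eq mult.commute)
qed

text \<open>The average is a step-function integral, and the ratios converge at every x > 0. A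
  constant dominates because all ratios lie in a fixed bounded interval and
  \<open>cmod z > 0\<close> keeps the maximum away from 0.\<close>

lemma mean_log_limit:
  assumes "z \<noteq> 0"
  shows "(\<lambda>n. mean_log n z) \<longlonglongrightarrow> (\<integral>x. ln (max (cmod z) (limit_radius t x)) \<partial>unif01)"
proof -
  have "(\<lambda>n. \<integral>x. ln (max (cmod z) (coeff_ratio t (dord n) (nat \<lceil>real (n - dord n) * x\<rceil>))) \<partial>unif01)
          \<longlonglongrightarrow> (\<integral>x. ln (max (cmod z) (limit_radius t x)) \<partial>unif01)"
  proof (rule integral_dominated_convergence[where w = "\<lambda>_. \<bar>ln (cmod z)\<bar> + ln (1 / (1 - t)\<^sup>2)"])
    show "AE x in unif01. (\<lambda>n. ln (max (cmod z) (coeff_ratio t (dord n) (nat \<lceil>real (n - dord n) * x\<rceil>))))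
             \<longlonglongrightarrow> ln (max (cmod z) (limit_radius t x))"
      using AE_unif01 AE_unif01_neq[of 0]
    proof eventually_elim
      case (elim x)
      have "max (cmod z) (limit_radius t x) > 0" using assms by (simp add: less_max_iff_disj)
      with elim show ?case by (intro tendsto_intros coeff_ratio_limit) auto
    qed
    fix n
    show "AE x in unif01. norm (ln (max (cmod z) (coeff_ratio t (dord n) (nat \<lceil>real (n - dord n) * x\<rceil>))))
            \<le> \<bar>ln (cmod z)\<bar> + ln (1 / (1 - t)\<^sup>2)"
      using assms unfolding real_norm_def by (intro AE_I2 abs_ln_max_le coeff_ratio_bounds G_ge_1) auto
  qed auto
  moreover have "\<forall>\<^sub>F n in sequentially. (\<integral>x. ln (max (cmod z) (coeff_ratio t (dord n) (nat \<lceil>real (n - dord n) * x\<rceil>))) \<partial>unif01) = mean_log n z"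
    using eventually_compose_filterlim[OF eventually_gt_at_top[of 0] degree_at_top]
  proof eventually_elim
    case (elim n)
    show ?case unfolding mean_log_def
      by (subst integral_unif01_step[OF elim, where \<phi> = "\<lambda>j. ln (max (cmod z) (coeff_ratio t (dord n) j))"]) simp
  qed
  ultimately show ?thesis using tendsto_cong by force
qed

lemma borel_measurable_mean_log [measurable]: "mean_log n \<in> borel_measurable borel"
  unfolding mean_log_def by measurable

text \<open>A second dominated convergence, now in z, with a majorant that has only an integrable
  logarithmic singularity at 0.\<close>

lemma mean_log_integral_limit:
  assumes "compact_bounded \<psi> b B"
  shows "integrable lborel (\<lambda>z. \<psi> z * mean_log n z)"
    and "(\<lambda>n. \<integral>z. \<psi> z * mean_log n z \<partial>lborel) \<longlonglongrightarrow> (\<integral>a. log_pot \<psi> a \<partial>radial_law (limit_radius t))"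
proof -
  interpret compact_bounded \<psi> b B by fact
  define w where "w = (\<lambda>z. \<bar>\<psi> z * ln (cmod (z - 0))\<bar> + \<bar>\<psi> z * ln (1 / (1 - t)\<^sup>2)\<bar>)"
  have int_w: "integrable lborel w"
    unfolding w_def using integrable integrable_ln[of 0] by (intro Bochner_Integration.integrable_add integrable_abs) auto
  have G: "0 \<le> ln (1 / (1 - t)\<^sup>2)" using G_ge_1 by (rule ln_ge_zero)
  have le: "norm (\<psi> z * mean_log n z) \<le> w z" if "z \<noteq> 0" for z n
  proof -
    have "\<bar>\<psi> z\<bar> * \<bar>mean_log n z\<bar> \<le> \<bar>\<psi> z\<bar> * (\<bar>ln (cmod z)\<bar> + ln (1 / (1 - t)\<^sup>2))"
      using abs_mean_log_le[OF that] by (intro mult_left_mono) auto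
    thus ?thesis using G unfolding w_def by (simp only: abs_mult real_norm_def distrib_left diff_zero abs_of_nonneg)
  qed
  have ae: "AE z::complex in lborel. z \<noteq> 0" by (rule AE_lborel_singleton)
  show "integrable lborel (\<lambda>z. \<psi> z * mean_log n z)"
  proof (rule Bochner_Integration.integrable_bound[OF int_w])
    show "AE z in lborel. norm (\<psi> z * mean_log n z) \<le> norm (w z)"
      using ae by eventually_elim (use le in \<open>fastforce simp: w_def\<close>)
  qed measurable
  have "(\<lambda>n. \<integral>z. \<psi> z * mean_log n z \<partial>lborel)
     \<longlonglongrightarrow> (\<integral>z. \<psi> z * (\<integral>x. ln (max (cmod z) (limit_radius t x)) \<partial>unif01) \<partial>lborel)"
  proof (rule integral_dominated_convergence[OF _ _ int_w])
    show "AE z in lborel. (\<lambda>n. \<psi> z * mean_log n z) \<longlonglongrightarrow> \<psi> z * (\<integral>x. ln (max (cmod z) (limit_radius t x)) \<partial>unif01)"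
      using ae by eventually_elim (intro tendsto_mult tendsto_const mean_log_limit)
    show "AE z in lborel. norm (\<psi> z * mean_log n z) \<le> w z" for n
      using ae by eventually_elim (rule le)
  qed measurable
  also have "(\<integral>z. \<psi> z * (\<integral>x. ln (max (cmod z) (limit_radius t x)) \<partial>unif01) \<partial>lborel) = (\<integral>a. log_pot \<psi> a \<partial>radial_law (limit_radius t))"
    by (rule integral_log_pot_radial_law[symmetric, OF _ limit_radius_bounds AE_limit_radius_neq]) auto
  finally show "(\<lambda>n. \<integral>z. \<psi> z * mean_log n z \<partial>lborel) \<longlonglongrightarrow> (\<integral>a. log_pot \<psi> a \<partial>radial_law (limit_radius t))" .
qed

end
section \<open>Concentration of the empirical potential\<close>

context derivative_fraction
begin

text \<open>The factor of the Gaussian in coefficient j of the m-th derivative: differentiation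
  contributes \<open>(j + m)! / j!\<close>, written as a Pochhammer symbol, and rescaling
  contributes a power with the original index \<open>j + m\<close>.\<close>

definition weight :: "nat \<Rightarrow> nat \<Rightarrow> real" where
  "weight m j = ((1 - t)\<^sup>2) ^ (j + m) * pochhammer (real (Suc j)) m"

lemma weight_pos: "weight m j > 0"
  unfolding weight_def using t by (intro mult_pos_pos pochhammer_pos) auto

text \<open>Splitting off the first or the last factor of
  \<open>pochhammer (real (Suc j)) (Suc m)\<close> relates the symbols at j and j + 1.\<close>

lemma weight_Suc: "weight m j = weight m (Suc j) * coeff_ratio t m (Suc j)"
proof -
  have "real (Suc j) * pochhammer (real (Suc j) + 1) m = (real (Suc j) + real m) * pochhammer (real (Suc j)) m"
    using pochhammer_rec[of "real (Suc j)" m] pochhammer_rec'[of "real (Suc j)" m] by simp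
  hence "pochhammer (real (Suc j)) m = real (Suc j) * pochhammer (real (Suc (Suc j))) m / (real (Suc j) + real m)"
    by (simp add: field_simps)
  moreover have "(1 - t)\<^sup>2 \<noteq> 0" using t by auto
  ultimately show ?thesis unfolding weight_def coeff_ratio_def
    by simp
qed

lemma mono_coeff_ratio: "mono (coeff_ratio t m)"
proof (rule incseq_SucI)
  fix j
  have "real j / (real j + real m) \<le> real (Suc j) / (real (Suc j) + real m)"
    by (cases "j = 0") (auto simp: field_simps)
  hence "real j / (real j + real m) / (1 - t)\<^sup>2 \<le> real (Suc j) / (real (Suc j) + real m) / (1 - t)\<^sup>2"
    by (rule divide_right_mono) auto
  thus "coeff_ratio t m j \<le> coeff_ratio t m (Suc j)"
    unfolding coeff_ratio_def by (simp add: mult.commute)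
qed

text \<open>By \<open>maximal_term\<close> this is the largest of the
  \<open>weight (dord n) j * cmod z ^ j\<close> for z \<noteq> 0; the product form makes its
  logarithm a sum over j.\<close>

definition max_term :: "nat \<Rightarrow> complex \<Rightarrow> real" where
  "max_term n z = weight (dord n) (n - dord n) * (\<Prod>j=1..n - dord n. max (cmod z) (coeff_ratio t (dord n) j))"

lemma max_term_pos: "z \<noteq> 0 \<Longrightarrow> max_term n z > 0"
  unfolding max_term_def by (intro mult_pos_pos weight_pos prod_pos) (auto simp: less_max_iff_disj)

lemma borel_measurable_max_term [measurable]: "max_term n \<in> borel_measurable borel"
  unfolding max_term_def by measurable

lemma ln_max_term:
  assumes "z \<noteq> 0" "n - dord n > 0"
  shows "ln (max_term n z) = ln (weight (dord n) (n - dord n)) + real (n - dord n) * mean_log n z"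
proof -
  have pos: "max (cmod z) (coeff_ratio t (dord n) j) > 0" for j using assms by (simp add: less_max_iff_disj)
  hence "(\<Prod>j=1..n - dord n. max (cmod z) (coeff_ratio t (dord n) j)) > 0" by (intro prod_pos) auto
  hence "ln (max_term n z) = ln (weight (dord n) (n - dord n)) + ln (\<Prod>j=1..n - dord n. max (cmod z) (coeff_ratio t (dord n) j))"
    unfolding max_term_def using weight_pos by (intro ln_mult_pos)
  also have "ln (\<Prod>j=1..n - dord n. max (cmod z) (coeff_ratio t (dord n) j)) = real (n - dord n) * mean_log n z"
    unfolding mean_log_def using assms pos by (subst ln_prod) (auto simp: less_imp_neq[symmetric])
  finally show ?thesis .
qed

end

section \<open>The derivative as a random sum\<close>

lemma coeff_rand_poly: "coeff (rand_poly \<xi> n \<omega>) k = (if k \<le> n then \<xi> k \<omega> else 0)"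
  unfolding rand_poly_def by (simp add: coeff_sum)

locale random_derivative = iid_gaussians M \<xi> + derivative_fraction t
  for M :: "'a measure" and \<xi> :: "nat \<Rightarrow> 'a \<Rightarrow> complex" and t :: real
begin

definition dpoly :: "nat \<Rightarrow> 'a \<Rightarrow> complex poly" where
  "dpoly n \<omega> = (pderiv ^^ dord n) (pcompose (rand_poly \<xi> n \<omega>) [:0, (1 - t)\<^sup>2:])"

lemma coeff_dpoly:
  "coeff (dpoly n \<omega>) j = (if j + dord n \<le> n then of_real (weight (dord n) j) * \<xi> (j + dord n) \<omega> else 0)"
proof -
  have "of_real (pochhammer (real (Suc j)) m) = (pochhammer (of_nat (Suc j)) m :: complex)" for m
    by (simp flip: pochhammer_of_real)
  thus ?thesis
    unfolding dpoly_def coeff_higher_pderiv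
    by (simp add: coeff_pcompose_linear coeff_rand_poly weight_def del: of_nat_Suc)
qed

lemma degree_dpoly:
  assumes "\<xi> n \<omega> \<noteq> 0"
  shows "degree (dpoly n \<omega>) = n - dord n" "dpoly n \<omega> \<noteq> 0"
proof -
  have "coeff (dpoly n \<omega>) (n - dord n) \<noteq> 0"
    using assms dord_le[of n] weight_pos[of "dord n" "n - dord n"] by (simp add: coeff_dpoly)
  moreover have "degree (dpoly n \<omega>) \<le> n - dord n"
    by (intro degree_le) (auto simp: coeff_dpoly)
  ultimately show "degree (dpoly n \<omega>) = n - dord n" "dpoly n \<omega> \<noteq> 0"
    by (auto intro!: antisym le_degree)
qed

text \<open>Indexing by the original index k exhibits the value at z as a linear combination of the
  \<open>\<xi> k\<close>, the form to which the estimate for random sums applies.\<close>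

lemma poly_dpoly:
  "poly (dpoly n \<omega>) z = (\<Sum>k=dord n..n. of_real (weight (dord n) (k - dord n)) * z ^ (k - dord n) * \<xi> k \<omega>)"
proof -
  have deg: "degree (dpoly n \<omega>) \<le> n - dord n"
    by (intro degree_le) (auto simp: coeff_dpoly)
  have "poly (dpoly n \<omega>) z = (\<Sum>j\<le>n - dord n. coeff (dpoly n \<omega>) j * z ^ j)"
    unfolding poly_altdef using deg by (intro sum.mono_neutral_left) (auto simp: coeff_eq_0 not_le)
  also have "\<dots> = (\<Sum>k=dord n..n. of_real (weight (dord n) (k - dord n)) * z ^ (k - dord n) * \<xi> k \<omega>)"
  proof -
    obtain m where m: "m = dord n" "m \<le> n" using dord_le by blast
    show ?thesis unfolding coeff_dpoly m(1)[symmetric] using m(2)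
      by (intro sum.reindex_bij_witness[of _ "\<lambda>k. k - m" "\<lambda>j. j + m"]) auto
  qed
  finally show ?thesis .
qed

lemma measurable_poly_dpoly [measurable]:
  "(\<lambda>(\<omega>, z). poly (dpoly n \<omega>) z) \<in> borel_measurable (M \<Otimes>\<^sub>M borel)"
  unfolding poly_dpoly by measurable

definition log_dev_bound :: "nat \<Rightarrow> ennreal" where
  "log_dev_bound n = log_mass + gaussian_abs_moment + ennreal (ln (Suc (n - dord n)))"

text \<open>Divided by the maximal term, all coefficients have modulus at most 1 and one has modulus
  exactly 1, the normalisation under which random sums were estimated. The bound is free of z, so it
  can be integrated against a density.\<close>

lemma expected_log_deviation_le:
  assumes z: "z \<noteq> 0"
  shows "(\<integral>\<^sup>+\<omega>. ennreal \<bar>ln (cmod (poly (dpoly n \<omega>) z / max_term n z))\<bar> \<partial>M) \<le> log_dev_bound n"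
proof -
  define m where "m = dord n"
  define c where "c = (\<lambda>k. of_real (weight m (k - m)) * z ^ (k - m) / of_real (max_term n z))"
  have M: "max_term n z > 0" using z by (rule max_term_pos)
  have norm_c: "cmod (c k) = weight m (k - m) * cmod z ^ (k - m) / max_term n z" for k
    using M weight_pos[of m "k - m"] by (simp add: c_def norm_mult norm_divide norm_power)
  note mt = maximal_term[of "weight m" "coeff_ratio t m" "cmod z", OF weight_pos weight_Suc mono_coeff_ratio]
  obtain j where j: "j \<le> n - m" "weight m j * cmod z ^ j = max_term n z"
    using mt(2)[of "n - m"] z unfolding max_term_def m_def by auto
  have card: "card {m..n} = Suc (n - m)" using dord_le[of n, folded m_def] by (simp add: Suc_diff_le)
  have "(\<integral>\<^sup>+\<omega>. ennreal \<bar>ln (cmod (\<Sum>k\<in>{m..n}. c k * \<xi> k \<omega>))\<bar> \<partial>M)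
       \<le> log_mass + gaussian_abs_moment + ennreal (ln (card {m..n}))"
  proof (rule nn_integral_abs_ln_sum_le[where i = "j + m"])
    show "j + m \<in> {m..n}" using j dord_le[of n, folded m_def] by auto
    show "cmod (c (j + m)) = 1" unfolding norm_c using j M by simp
    fix k assume k: "k \<in> {m..n}"
    have "weight m (k - m) * cmod z ^ (k - m) \<le> max_term n z"
      using mt(1)[of "k - m" "n - m"] z k unfolding max_term_def m_def by auto
    thus "cmod (c k) \<le> 1" unfolding norm_c using M by simp
  qed auto
  moreover have "(\<Sum>k\<in>{m..n}. c k * \<xi> k \<omega>) = poly (dpoly n \<omega>) z / of_real (max_term n z)" for \<omega>
    unfolding poly_dpoly c_def m_def sum_divide_distrib by simp
  ultimately show ?thesis unfolding log_dev_bound_def card by (simp add: m_def)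
qed

text \<open>The expected deviation grows like a logarithm, while division by the degree gains a
  linear factor.\<close>

lemma log_dev_bound_small:
  assumes "c > 0"
  shows "\<forall>\<^sub>F n in sequentially. log_dev_bound n \<le> ennreal (c * real (n - dord n))"
proof -
  obtain a where a: "log_mass + gaussian_abs_moment = ennreal a" "a \<ge> 0"
    using log_mass_finite gaussian_abs_moment_finite
    by (cases "log_mass + gaussian_abs_moment") auto
  have "\<forall>\<^sub>F N::nat in sequentially. a + ln (real (Suc N)) \<le> c * real N"
    using assms by real_asymp
  hence "\<forall>\<^sub>F n in sequentially. a + ln (real (Suc (n - dord n))) \<le> c * real (n - dord n)"
    using degree_at_top by (rule eventually_compose_filterlim)
  thus ?thesis
  proof eventually_elim
    case (elim n)
    have "log_dev_bound n = ennreal (a + ln (real (Suc (n - dord n))))"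
      unfolding log_dev_bound_def a using a(2) by simp
    thus ?case using elim by (simp add: ennreal_leI)
  qed
qed

interpretation M_lborel: pair_sigma_finite M "lborel :: complex measure"
  by standard

lemma AE_xi_nonzero: "AE \<omega> in M. \<xi> n \<omega> \<noteq> 0"
proof -
  have "AE z in std_complex_gaussian. z \<noteq> 0"
    unfolding std_complex_gaussian_def by (subst AE_density) (use AE_lborel_singleton[of "0::complex"] in auto)
  thus ?thesis unfolding law[of n, symmetric] by (subst (asm) AE_distr_iff) auto
qed

text \<open>Taken as a nonnegative extended integral, so that Tonelli and Markov apply before
  anything is known to be integrable.\<close>

definition log_deviation :: "(complex \<Rightarrow> real) \<Rightarrow> nat \<Rightarrow> 'a \<Rightarrow> ennreal" where
  "log_deviation \<psi> n \<omega> = (\<integral>\<^sup>+z. ennreal (\<bar>\<psi> z\<bar> * \<bar>ln (cmod (poly (dpoly n \<omega>) z / max_term n z))\<bar>) \<partial>lborel)"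

context
  fixes \<psi> :: "complex \<Rightarrow> real" and b B :: real
  assumes cb: "compact_bounded \<psi> b B" and zero: "(\<integral>z. \<psi> z \<partial>lborel) = 0"
begin

interpretation compact_bounded \<psi> b B by (rule cb)

lemma measurable_log_deviation [measurable]: "log_deviation \<psi> n \<in> borel_measurable M"
  unfolding log_deviation_def by measurable

lemma nn_integral_log_deviation_le:
  "(\<integral>\<^sup>+\<omega>. log_deviation \<psi> n \<omega> \<partial>M) \<le> (\<integral>\<^sup>+z. ennreal \<bar>\<psi> z\<bar> \<partial>lborel) * log_dev_bound n"
proof -
  have "(\<integral>\<^sup>+\<omega>. log_deviation \<psi> n \<omega> \<partial>M)
    = (\<integral>\<^sup>+z. \<integral>\<^sup>+\<omega>. ennreal (\<bar>\<psi> z\<bar> * \<bar>ln (cmod (poly (dpoly n \<omega>) z / max_term n z))\<bar>) \<partial>M \<partial>lborel)"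
    unfolding log_deviation_def by (rule M_lborel.Fubini'[symmetric]) measurable
  also have "\<dots> = (\<integral>\<^sup>+z. ennreal \<bar>\<psi> z\<bar> * (\<integral>\<^sup>+\<omega>. ennreal (\<bar>ln (cmod (poly (dpoly n \<omega>) z / max_term n z))\<bar>) \<partial>M) \<partial>lborel)"
    by (intro nn_integral_cong) (simp add: ennreal_mult nn_integral_cmult)
  also have "\<dots> \<le> (\<integral>\<^sup>+z. ennreal \<bar>\<psi> z\<bar> * log_dev_bound n \<partial>lborel)"
  proof (rule nn_integral_mono_AE)
    show "AE z in lborel. ennreal \<bar>\<psi> z\<bar> * (\<integral>\<^sup>+\<omega>. ennreal (\<bar>ln (cmod (poly (dpoly n \<omega>) z / max_term n z))\<bar>) \<partial>M)
            \<le> ennreal \<bar>\<psi> z\<bar> * log_dev_bound n"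
      using AE_lborel_singleton[of "0::complex"]
      by eventually_elim (intro mult_left_mono expected_log_deviation_le, auto)
  qed
  also have "\<dots> = (\<integral>\<^sup>+z. ennreal \<bar>\<psi> z\<bar> \<partial>lborel) * log_dev_bound n"
    by (rule nn_integral_multc) measurable
  finally show ?thesis .
qed

text \<open>A nonzero \<open>\<xi> n\<close> gives the full degree, so the average over the roots
  and \<open>mean_log\<close> are normalised by the same number.\<close>

lemma empirical_log_pot_close:
  assumes xi: "\<xi> n \<omega> \<noteq> 0" and N: "n - dord n > 0" and \<omega>: "\<omega> \<in> space M"
    and dev: "log_deviation \<psi> n \<omega> < ennreal (\<epsilon> * real (n - dord n))" and eps: "\<epsilon> > 0"
  shows "\<bar>(\<integral>a. log_pot \<psi> a \<partial>empirical_root_measure (dpoly n \<omega>)) - (\<integral>z. \<psi> z * mean_log n z \<partial>lborel)\<bar> \<le> \<epsilon>"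
proof -
  define N where "N = real (n - dord n)"
  have N0: "N > 0" using N by (simp add: N_def)
  define p where "p = dpoly n \<omega>"
  have p: "p \<noteq> 0" "degree p = n - dord n" using degree_dpoly[OF xi] by (auto simp: p_def)
  have sz: "size (proots p) = n - dord n" using p by (simp add: size_proots_complex)
  hence "proots p \<noteq> {#}" using N by auto
  hence emp: "(\<integral>a. log_pot \<psi> a \<partial>empirical_root_measure p) = (\<integral>z. \<psi> z * ln (cmod (poly p z)) \<partial>lborel) / N"
    unfolding empirical_root_measure_def
    by (simp add: expectation_pmf_of_multiset integral_ln_poly[OF p(1) zero] sz N_def)
  define W where "W = ln (weight (dord n) (n - dord n))"
  note intm = mean_log_integral_limit(1)[OF cb, of n]
  note intp = integral_ln_poly(1)[OF p(1) zero]
  \<comment> \<open>Its integral is N times the error, because the term with \<open>W\<close>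
    integrates to zero; almost everywhere it is \<psi> times the logarithm of the polynomial over
    its maximal term.\<close>
  define D where "D = (\<lambda>z. \<psi> z * ln (cmod (poly p z)) - (\<psi> z * W + N * (\<psi> z * mean_log n z)))"
  have intD: "integrable lborel D"
    unfolding D_def using intm intp integrable by auto
  have valD: "(\<integral>z. D z \<partial>lborel) = (\<integral>z. \<psi> z * ln (cmod (poly p z)) \<partial>lborel) - N * (\<integral>z. \<psi> z * mean_log n z \<partial>lborel)"
    unfolding D_def using intm intp integrable zero by simp
  have "finite {z. poly p z = 0}" using p by (simp add: poly_roots_finite)
  hence ae: "AE z in lborel. poly p z \<noteq> 0"
    by (intro AE_I'[of "{z. poly p z = 0}"] finite_imp_null_set_lborel) auto
  have "ennreal (norm (\<integral>z. D z \<partial>lborel)) \<le> (\<integral>\<^sup>+z. norm (D z) \<partial>lborel)"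
    using intD by (rule integral_norm_bound_ennreal)
  also have "\<dots> = log_deviation \<psi> n \<omega>"
    unfolding log_deviation_def p_def[symmetric]
  proof (rule nn_integral_cong_AE)
    show "AE z in lborel. ennreal (norm (D z)) = ennreal (\<bar>\<psi> z\<bar> * \<bar>ln (cmod (poly p z / max_term n z))\<bar>)"
      using ae AE_lborel_singleton[of "0::complex"]
    proof eventually_elim
      case (elim z)
      have "ln (cmod (poly p z / max_term n z)) = ln (cmod (poly p z)) - ln (max_term n z)"
        using elim max_term_pos[of z n] by (simp add: norm_divide ln_div)
      also have "ln (max_term n z) = W + N * mean_log n z"
        unfolding W_def N_def using elim N by (simp add: ln_max_term)
      finally have eq: "ln (cmod (poly p z / max_term n z)) = ln (cmod (poly p z)) - (W + N * mean_log n z)" .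
      have "D z = \<psi> z * ln (cmod (poly p z / max_term n z))"
        unfolding D_def eq by (simp add: algebra_simps)
      thus ?case by (simp add: abs_mult)
    qed
  qed
  also have "\<dots> < ennreal (\<epsilon> * N)" using dev by (simp add: N_def)
  finally have "\<bar>\<integral>z. D z \<partial>lborel\<bar> < \<epsilon> * N"
    using eps N0 by (simp add: ennreal_less_iff)
  hence "\<bar>\<integral>z. D z \<partial>lborel\<bar> / N \<le> \<epsilon>" using N0 by (simp add: divide_le_eq)
  moreover have "(\<integral>a. log_pot \<psi> a \<partial>empirical_root_measure p) - (\<integral>z. \<psi> z * mean_log n z \<partial>lborel) = (\<integral>z. D z \<partial>lborel) / N"
    unfolding emp valD using N0 by (simp add: field_simps)
  ultimately show ?thesis using N0 by (simp add: p_def)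
qed

lemma log_pot_converges:
  assumes eps: "\<epsilon> > 0" and delta: "\<delta> > 0"
  shows "\<forall>\<^sub>F n in sequentially. \<exists>A\<in>sets M. prob A < \<delta> \<and>
           (\<forall>\<omega>\<in>space M - A. \<bar>(\<integral>a. log_pot \<psi> a \<partial>empirical_root_measure (dpoly n \<omega>))
                    - (\<integral>a. log_pot \<psi> a \<partial>radial_law (limit_radius t))\<bar> \<le> \<epsilon>)"
proof -
  obtain I where I: "(\<integral>\<^sup>+z. ennreal \<bar>\<psi> z\<bar> \<partial>lborel) = ennreal I" "I \<ge> 0"
    using integrable unfolding integrable_iff_bounded
    by (cases "\<integral>\<^sup>+z. ennreal \<bar>\<psi> z\<bar> \<partial>lborel") auto
  \<comment> \<open>Makes Markov's bound \<open>I * (c * N) / (\<epsilon> / 2 * N)\<close> at most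
    \<delta> / 2; the summand 1 guards against I = 0.\<close>
  define c where "c = \<epsilon> / 2 * (\<delta> / 2) / (I + 1)"
  have c: "c > 0" using eps delta I by (simp add: c_def)
  have ev1: "\<forall>\<^sub>F n in sequentially. \<bar>(\<integral>z. \<psi> z * mean_log n z \<partial>lborel) - (\<integral>a. log_pot \<psi> a \<partial>radial_law (limit_radius t))\<bar> < \<epsilon> / 2"
    using tendstoD[OF mean_log_integral_limit(2)[OF cb], of "\<epsilon> / 2"] eps by (simp add: dist_real_def)
  have ev2: "\<forall>\<^sub>F n in sequentially. n - dord n > 0"
    by (rule eventually_compose_filterlim[OF eventually_gt_at_top[of 0] degree_at_top])
  from ev1 ev2 log_dev_bound_small[OF c] show ?thesis
  proof eventually_elim
    case (elim n)
    define N where "N = real (n - dord n)"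
    have N: "N > 0" using elim by (simp add: N_def)
    define s where "s = \<epsilon> / 2 * N"
    have s: "s > 0" using eps N by (simp add: s_def)
    \<comment> \<open>This set has the shape of Markov's inequality; the null set \<open>A2\<close>
      is where the degree drops.\<close>
    define A1 where "A1 = {\<omega> \<in> space M. 1 \<le> ennreal (1 / s) * log_deviation \<psi> n \<omega>}"
    define A2 where "A2 = {\<omega> \<in> space M. \<xi> n \<omega> = 0}"
    have [measurable]: "A1 \<in> sets M" "A2 \<in> sets M" unfolding A1_def A2_def by measurable
    have "emeasure M A1 \<le> ennreal (1 / s) * (\<integral>\<^sup>+\<omega>. log_deviation \<psi> n \<omega> * indicator (space M) \<omega> \<partial>M)"
      unfolding A1_def by (rule nn_integral_Markov_inequality) auto
    also have "(\<integral>\<^sup>+\<omega>. log_deviation \<psi> n \<omega> * indicator (space M) \<omega> \<partial>M) = (\<integral>\<^sup>+\<omega>. log_deviation \<psi> n \<omega> \<partial>M)"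
      by (intro nn_integral_cong) auto
    also have "ennreal (1 / s) * \<dots> \<le> ennreal (1 / s) * (ennreal I * ennreal (c * N))"
      unfolding I(1)[symmetric] N_def
      by (intro mult_left_mono order.trans[OF nn_integral_log_deviation_le] elim) auto
    also have "\<dots> = ennreal (1 / s * (I * (c * N)))"
    proof -
      have "ennreal (1 / s * (I * (c * N))) = ennreal (1 / s) * ennreal (I * (c * N))"
        using s I c N by (intro ennreal_mult) auto
      also have "ennreal (I * (c * N)) = ennreal I * ennreal (c * N)"
        using I c N by (intro ennreal_mult) auto
      finally show ?thesis ..
    qed
    also have "1 / s * (I * (c * N)) = I / (I + 1) * (\<delta> / 2)"
      using N eps I by (simp add: s_def c_def field_simps)
    also have "\<dots> \<le> 1 * (\<delta> / 2)"
      using I delta by (intro mult_right_mono) auto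
    finally have "prob A1 \<le> \<delta> / 2"
      using delta by (simp add: emeasure_eq_measure ennreal_leI)
    moreover have "prob A2 = 0"
      using AE_xi_nonzero[of n] unfolding A2_def
      by (subst prob_eq_0) (auto)
    moreover have "prob (A1 \<union> A2) \<le> prob A1 + prob A2" by (rule measure_Un_le) auto
    ultimately have prob: "prob (A1 \<union> A2) < \<delta>" using delta by linarith
    show ?case
    proof (intro bexI[of _ "A1 \<union> A2"] conjI ballI prob)
      fix \<omega> assume \<omega>: "\<omega> \<in> space M - (A1 \<union> A2)"
      have "log_deviation \<psi> n \<omega> < ennreal s"
      proof (rule ccontr)
        assume "\<not> ?thesis"
        hence "ennreal (1 / s) * ennreal s \<le> ennreal (1 / s) * log_deviation \<psi> n \<omega>"
          by (intro mult_left_mono) auto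
        moreover have "ennreal (1 / s) * ennreal s = 1" using s by (simp flip: ennreal_mult)
        ultimately show False using \<omega> by (auto simp: A1_def)
      qed
      hence "\<bar>(\<integral>a. log_pot \<psi> a \<partial>empirical_root_measure (dpoly n \<omega>)) - (\<integral>z. \<psi> z * mean_log n z \<partial>lborel)\<bar> \<le> \<epsilon> / 2"
        using \<omega> elim eps by (intro empirical_log_pot_close) (auto simp: A2_def s_def N_def)
      thus "\<bar>(\<integral>a. log_pot \<psi> a \<partial>empirical_root_measure (dpoly n \<omega>))
                    - (\<integral>a. log_pot \<psi> a \<partial>radial_law (limit_radius t))\<bar> \<le> \<epsilon>"
        using elim(1) by linarith
    qed auto
  qed
qed

end

end
section \<open>Convergence of the empirical measures\<close>

lemma (in prob_space) abs_integral_diff_le: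
  fixes f g :: "'a \<Rightarrow> real"
  assumes [measurable]: "f \<in> borel_measurable M" "g \<in> borel_measurable M"
    and "\<And>x. \<bar>f x\<bar> \<le> b" and d: "\<And>x. \<bar>f x - g x\<bar> \<le> e"
  shows "\<bar>(\<integral>x. f x \<partial>M) - (\<integral>x. g x \<partial>M)\<bar> \<le> e"
proof -
  have f: "integrable M f" using assms by (intro integrable_const_bound[where B=b]) auto
  have "\<bar>g x\<bar> \<le> b + e" for x using assms(3)[of x] d[of x] by linarith
  hence g: "integrable M g" by (intro integrable_const_bound[where B="b + e"]) auto
  have "\<bar>(\<integral>x. f x \<partial>M) - (\<integral>x. g x \<partial>M)\<bar> = \<bar>\<integral>x. f x - g x \<partial>M\<bar>" using f g by simp
  also have "\<dots> \<le> (\<integral>x. \<bar>f x - g x\<bar> \<partial>M)" by (rule integral_abs_bound)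
  also have "\<dots> \<le> (\<integral>x. e \<partial>M)" using f g d by (intro integral_mono) auto
  finally show ?thesis by (simp add: prob_space)
qed

lemma sets_radial_law [measurable_cong]: "sets (radial_law g) = sets borel"
  by (simp add: radial_law_def)

lemma prob_space_radial_law:
  assumes [measurable]: "g \<in> borel_measurable borel"
  shows "prob_space (radial_law g)"
  unfolding radial_law_def by (intro unif01_sq.P.prob_space_distr) measurable

lemma AE_radial_law_le:
  assumes [measurable]: "g \<in> borel_measurable borel" and gb: "\<And>x. x \<in> {0..1} \<Longrightarrow> 0 \<le> g x \<and> g x \<le> G"
  shows "AE a in radial_law g. cmod a \<le> G"
proof -
  have "AE p in unif01_sq. fst p \<in> {0..1}"
    using AE_unif01 by (rule AE_unif01_sq_fst) auto
  hence "AE p in unif01_sq. cmod (of_real (g (fst p)) * ecis (snd p)) \<le> G"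
    by eventually_elim (use gb in \<open>auto simp: norm_mult\<close>)
  thus ?thesis unfolding radial_law_def by (subst AE_distr_iff) (auto simp: case_prod_unfold)
qed

lemma prob_space_empirical_root_measure: "prob_space (empirical_root_measure p)"
  unfolding empirical_root_measure_def by (rule measure_pmf.prob_space_axioms)

text \<open>A \<open>pmf\<close> carries the discrete sigma-algebra.\<close>

lemma borel_measurable_empirical_root_measure [simp]:
  "f \<in> borel_measurable (empirical_root_measure p)"
  unfolding empirical_root_measure_def by simp

context random_derivative
begin

text \<open>Convergence in probability for a single test function. The deviation event is covered by
  a measurable set, so measurability of the roots in \<omega> never has to be discussed.\<close>

definition converges_on :: "(complex \<Rightarrow> real) \<Rightarrow> bool" where
  "converges_on f \<longleftrightarrow> (\<forall>\<epsilon>>0. \<forall>\<delta>>0. \<forall>\<^sub>F n in sequentially. \<exists>A\<in>sets M. prob A < \<delta> \<and>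
     (\<forall>\<omega>\<in>space M - A. \<bar>(\<integral>a. f a \<partial>empirical_root_measure (dpoly n \<omega>))
                    - (\<integral>a. f a \<partial>radial_law (limit_radius t))\<bar> \<le> \<epsilon>))"

lemma prob_space_limit: "prob_space (radial_law (limit_radius t))"
  by (rule prob_space_radial_law) measurable

text \<open>Uniform approximation costs at most \<epsilon> / 3 under every probability measure, thus
  under the random and the limiting one alike; the convergence of the potential takes the last
  third.\<close>

lemma compact_bounded_converges_on:
  assumes cb: "compact_bounded f b B" and cont: "continuous_on UNIV f"
  shows "converges_on f"
  unfolding converges_on_def
proof (intro allI impI)
  fix \<epsilon> \<delta> :: real assume eps: "\<epsilon> > 0" and delta: "\<delta> > 0"
  interpret compact_bounded f b B by (rule cb)
  obtain \<phi> b' B' where \<phi>: "compact_bounded \<phi> b' B'" "(\<integral>z. \<phi> z \<partial>lborel) = 0" "\<And>a. \<bar>f a - log_pot \<phi> a\<bar> \<le> \<epsilon> / 3"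
    using ex_log_pot_approx[OF cont, of "\<epsilon> / 3"] eps by auto
  have [measurable]: "\<phi> \<in> borel_measurable borel" by (rule compact_bounded.meas[OF \<phi>(1)])
  have lim: "\<bar>(\<integral>a. f a \<partial>radial_law (limit_radius t)) - (\<integral>a. log_pot \<phi> a \<partial>radial_law (limit_radius t))\<bar> \<le> \<epsilon> / 3"
    by (rule prob_space.abs_integral_diff_le[OF prob_space_limit _ _ abs_le_b \<phi>(3)]) measurable
  have emp: "\<bar>(\<integral>a. f a \<partial>empirical_root_measure p) - (\<integral>a. log_pot \<phi> a \<partial>empirical_root_measure p)\<bar> \<le> \<epsilon> / 3" for p
    by (rule prob_space.abs_integral_diff_le[OF prob_space_empirical_root_measure _ _ abs_le_b \<phi>(3)]) simp_all
  have "\<epsilon> / 3 > 0" using eps by simp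
  from log_pot_converges[OF \<phi>(1,2) this delta]
  show "\<forall>\<^sub>F n in sequentially. \<exists>A\<in>sets M. prob A < \<delta> \<and>
     (\<forall>\<omega>\<in>space M - A. \<bar>(\<integral>a. f a \<partial>empirical_root_measure (dpoly n \<omega>))
                    - (\<integral>a. f a \<partial>radial_law (limit_radius t))\<bar> \<le> \<epsilon>)"
  proof eventually_elim
    case (elim n)
    then obtain A where A: "A \<in> sets M" "prob A < \<delta>"
      "\<And>\<omega>. \<omega> \<in> space M - A \<Longrightarrow> \<bar>(\<integral>a. log_pot \<phi> a \<partial>empirical_root_measure (dpoly n \<omega>))
                    - (\<integral>a. log_pot \<phi> a \<partial>radial_law (limit_radius t))\<bar> \<le> \<epsilon> / 3"
      by blast
    have "\<bar>(\<integral>a. f a \<partial>empirical_root_measure (dpoly n \<omega>)) - (\<integral>a. f a \<partial>radial_law (limit_radius t))\<bar> \<le> \<epsilon>"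
      if "\<omega> \<in> space M - A" for \<omega>
      using A(3)[OF that] emp[of "dpoly n \<omega>"] lim by linarith
    thus ?case using A(1,2) by blast
  qed
qed

text \<open>Two functions of compact support are tested: f times a cutoff, and the cutoff itself.
  The limit law sits where the cutoff is 1, so the second test shows that little empirical mass is
  left out, and there f is bounded by K.\<close>

lemma bounded_converges_on:
  fixes f :: "complex \<Rightarrow> real"
  assumes cont: "continuous_on UNIV f" and K: "\<And>z. \<bar>f z\<bar> \<le> K"
  shows "converges_on f"
  unfolding converges_on_def
proof (intro allI impI)
  fix \<epsilon> \<delta> :: real assume eps: "\<epsilon> > 0" and delta: "\<delta> > 0"
  define R where "R = 1 / (1 - t)"
  have R: "R > 0" using t by (simp add: R_def)
  define cut where "cut = (\<lambda>z::complex. max 0 (min 1 (R + 1 - cmod z)))"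
  have cut: "0 \<le> cut z" "cut z \<le> 1" for z by (auto simp: cut_def)
  have cut1: "cut z = 1" if "cmod z \<le> R" for z using that by (auto simp: cut_def)
  have cut0: "cut z = 0" if "cmod z > R + 1" for z using that by (auto simp: cut_def)
  have cont_cut: "continuous_on UNIV cut" unfolding cut_def by (intro continuous_intros)
  have K0: "K \<ge> 0" using K[of 0] by linarith
  have meas [measurable]: "f \<in> borel_measurable borel" "cut \<in> borel_measurable borel"
    using cont cont_cut by (auto intro: borel_measurable_continuous_onI)
  have cb1: "compact_bounded cut 1 (R + 1)"
    by standard (use R cut cut0 in \<open>auto simp: indicator_def\<close>)
  have cb2: "compact_bounded (\<lambda>z. f z * cut z) K (R + 1)"
  proof
    fix z
    show "\<bar>f z * cut z\<bar> \<le> K * indicator (cball 0 (R + 1)) z"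
    proof (cases "cmod z \<le> R + 1")
      case True
      have "\<bar>f z\<bar> * \<bar>cut z\<bar> \<le> K * 1" using K[of z] cut[of z] K0 by (intro mult_mono) auto
      thus ?thesis using True by (simp add: abs_mult)
    qed (use cut0[of z] in auto)
  qed (use R in auto)
  let ?\<nu> = "radial_law (limit_radius t)"
  have ae: "AE a in ?\<nu>. cut a = 1"
  proof -
    have "AE a in ?\<nu>. cmod a \<le> 1 / (1 - t)"
      by (rule AE_radial_law_le[OF borel_measurable_limit_radius]) (rule limit_radius_bounds)
    thus ?thesis by eventually_elim (use cut1 in \<open>auto simp: R_def\<close>)
  qed
  have nu1: "(\<integral>a. cut a \<partial>?\<nu>) = 1"
  proof -
    have "(\<integral>a. cut a \<partial>?\<nu>) = (\<integral>a. 1 \<partial>?\<nu>)" using ae by (intro integral_cong_AE) auto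
    thus ?thesis using prob_space.prob_space[OF prob_space_limit] by simp
  qed
  have nu2: "(\<integral>a. f a * cut a \<partial>?\<nu>) = (\<integral>a. f a \<partial>?\<nu>)"
    using ae by (intro integral_cong_AE) auto
  have tail: "\<bar>(\<integral>a. f a \<partial>empirical_root_measure p) - (\<integral>a. f a * cut a \<partial>empirical_root_measure p)\<bar>
                \<le> K * (1 - (\<integral>a. cut a \<partial>empirical_root_measure p))" for p
  proof -
    interpret E: prob_space "empirical_root_measure p" by (rule prob_space_empirical_root_measure)
    have i1: "integrable (empirical_root_measure p) f" using K by (intro E.integrable_const_bound[where B=K]) auto
    have i2: "integrable (empirical_root_measure p) cut" using cut by (intro E.integrable_const_bound[where B=1]) auto
    have i3: "integrable (empirical_root_measure p) (\<lambda>z. f z * cut z)"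
      using compact_bounded.abs_le_b[OF cb2] by (intro E.integrable_const_bound[where B=K]) auto
    have "\<bar>(\<integral>a. f a \<partial>empirical_root_measure p) - (\<integral>a. f a * cut a \<partial>empirical_root_measure p)\<bar>
        = \<bar>\<integral>a. f a - f a * cut a \<partial>empirical_root_measure p\<bar>" using i1 i3 by simp
    also have "\<dots> \<le> (\<integral>a. \<bar>f a - f a * cut a\<bar> \<partial>empirical_root_measure p)" by (rule integral_abs_bound)
    also have "\<dots> \<le> (\<integral>a. K * (1 - cut a) \<partial>empirical_root_measure p)"
    proof (rule integral_mono)
      fix a
      have "f a - f a * cut a = f a * (1 - cut a)" by (simp add: algebra_simps)
      thus "\<bar>f a - f a * cut a\<bar> \<le> K * (1 - cut a)"
        using K[of a] cut[of a] by (simp add: abs_mult mult_right_mono)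
    qed (use i1 i2 i3 in auto)
    also have "\<dots> = K * (1 - (\<integral>a. cut a \<partial>empirical_root_measure p))"
      using i2 by (simp add: E.prob_space)
    finally show ?thesis .
  qed
  \<comment> \<open>The tolerance for the lost mass, which gets multiplied by K; using K + 1 allows
    for K = 0.\<close>
  define e2 where "e2 = \<epsilon> / (2 * (K + 1))"
  have e2: "e2 > 0" "K * e2 \<le> \<epsilon> / 2" using eps K0 by (auto simp: e2_def field_simps)
  have conv1: "converges_on (\<lambda>z. f z * cut z)"
    by (rule compact_bounded_converges_on[OF cb2]) (intro continuous_intros cont cont_cut)
  have ev1: "\<forall>\<^sub>F n in sequentially. \<exists>A\<in>sets M. prob A < \<delta> / 2 \<and>
     (\<forall>\<omega>\<in>space M - A. \<bar>(\<integral>a. f a * cut a \<partial>empirical_root_measure (dpoly n \<omega>)) - (\<integral>a. f a * cut a \<partial>?\<nu>)\<bar> \<le> \<epsilon> / 2)"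
    by (rule conv1[unfolded converges_on_def, rule_format]) (use eps delta in auto)
  have conv2: "converges_on cut" by (rule compact_bounded_converges_on[OF cb1 cont_cut])
  have ev2: "\<forall>\<^sub>F n in sequentially. \<exists>A\<in>sets M. prob A < \<delta> / 2 \<and>
     (\<forall>\<omega>\<in>space M - A. \<bar>(\<integral>a. cut a \<partial>empirical_root_measure (dpoly n \<omega>)) - (\<integral>a. cut a \<partial>?\<nu>)\<bar> \<le> e2)"
    by (rule conv2[unfolded converges_on_def, rule_format]) (use e2 delta in auto)
  from ev1 ev2 show "\<forall>\<^sub>F n in sequentially. \<exists>A\<in>sets M. prob A < \<delta> \<and>
     (\<forall>\<omega>\<in>space M - A. \<bar>(\<integral>a. f a \<partial>empirical_root_measure (dpoly n \<omega>)) - (\<integral>a. f a \<partial>?\<nu>)\<bar> \<le> \<epsilon>)"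
  proof eventually_elim
    case (elim n)
    obtain A1 where A1: "A1 \<in> sets M" "prob A1 < \<delta> / 2"
      "\<And>\<omega>. \<omega> \<in> space M - A1 \<Longrightarrow> \<bar>(\<integral>a. f a * cut a \<partial>empirical_root_measure (dpoly n \<omega>)) - (\<integral>a. f a * cut a \<partial>?\<nu>)\<bar> \<le> \<epsilon> / 2"
      using elim(1) by blast
    obtain A2 where A2: "A2 \<in> sets M" "prob A2 < \<delta> / 2"
      "\<And>\<omega>. \<omega> \<in> space M - A2 \<Longrightarrow> \<bar>(\<integral>a. cut a \<partial>empirical_root_measure (dpoly n \<omega>)) - (\<integral>a. cut a \<partial>?\<nu>)\<bar> \<le> e2"
      using elim(2) by blast
    have "prob (A1 \<union> A2) \<le> prob A1 + prob A2" using A1 A2 by (intro measure_Un_le) auto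
    hence "prob (A1 \<union> A2) < \<delta>" using A1 A2 by linarith
    moreover have "\<bar>(\<integral>a. f a \<partial>empirical_root_measure (dpoly n \<omega>)) - (\<integral>a. f a \<partial>?\<nu>)\<bar> \<le> \<epsilon>"
      if "\<omega> \<in> space M - (A1 \<union> A2)" for \<omega>
    proof -
      have "1 - (\<integral>a. cut a \<partial>empirical_root_measure (dpoly n \<omega>)) \<le> e2"
        using A2(3)[of \<omega>] that nu1 by auto
      hence "K * (1 - (\<integral>a. cut a \<partial>empirical_root_measure (dpoly n \<omega>))) \<le> K * e2"
        using K0 by (intro mult_left_mono) auto
      with tail[of "dpoly n \<omega>"] e2(2)
      have "\<bar>(\<integral>a. f a \<partial>empirical_root_measure (dpoly n \<omega>)) - (\<integral>a. f a * cut a \<partial>empirical_root_measure (dpoly n \<omega>))\<bar> \<le> \<epsilon> / 2"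
        by linarith
      moreover have "\<bar>(\<integral>a. f a * cut a \<partial>empirical_root_measure (dpoly n \<omega>)) - (\<integral>a. f a \<partial>?\<nu>)\<bar> \<le> \<epsilon> / 2"
        using A1(3)[of \<omega>] that nu2 by auto
      ultimately show ?thesis by linarith
    qed
    ultimately show ?case using A1(1) A2(1) by (intro bexI[of _ "A1 \<union> A2"]) auto
  qed
qed

lemma weak_conv_dpoly:
  "weak_conv_in_prob M (\<lambda>n \<omega>. empirical_root_measure (dpoly n \<omega>)) (radial_law (limit_radius t))"
  unfolding weak_conv_in_prob_def
proof (intro allI impI)
  fix f :: "complex \<Rightarrow> real" and \<epsilon> \<delta> :: real
  assume f: "continuous_on UNIV f \<and> bounded (range f)" and ed: "\<epsilon> > 0" "\<delta> > 0"
  then obtain K where "\<And>z. \<bar>f z\<bar> \<le> K" unfolding bounded_iff by auto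
  hence "converges_on f" using f by (intro bounded_converges_on) auto
  hence "\<forall>\<^sub>F n in sequentially. \<exists>A\<in>sets M. prob A < \<delta> \<and>
     (\<forall>\<omega>\<in>space M - A. \<bar>(\<integral>a. f a \<partial>empirical_root_measure (dpoly n \<omega>))
                    - (\<integral>a. f a \<partial>radial_law (limit_radius t))\<bar> \<le> \<epsilon>)"
    using ed unfolding converges_on_def by blast
  thus "\<forall>\<^sub>F n in sequentially. \<exists>A\<in>sets M.
      {\<omega> \<in> space M. \<bar>(\<integral>z. f z \<partial>empirical_root_measure (dpoly n \<omega>)) - (\<integral>z. f z \<partial>radial_law (limit_radius t))\<bar> > \<epsilon>} \<subseteq> A
        \<and> measure M A < \<delta>"
  proof eventually_elim
    case (elim n)
    then obtain A where A: "A \<in> sets M" "prob A < \<delta>"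
      "\<And>\<omega>. \<omega> \<in> space M - A \<Longrightarrow> \<bar>(\<integral>a. f a \<partial>empirical_root_measure (dpoly n \<omega>))
                    - (\<integral>a. f a \<partial>radial_law (limit_radius t))\<bar> \<le> \<epsilon>"
      by blast
    show ?case using A(1,2) by (intro bexI[of _ A] conjI subsetI) (use A(3) in \<open>auto simp: not_less[symmetric]\<close>)
  qed
qed

end
section \<open>Radial measures and the free convolution power\<close>

lemma nn_integral_real_shift:
  fixes k :: "real \<Rightarrow> ennreal"
  assumes [measurable]: "k \<in> borel_measurable borel"
  shows "(\<integral>\<^sup>+y. k (y + a) \<partial>lborel) = (\<integral>\<^sup>+y. k y \<partial>lborel)"
  using nn_integral_lborel_translate[OF assms, of a] by (simp add: add.commute)

text \<open>The integrand has period 1: the shifted window from a to 1 + a is cut at 1 and its upper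
  piece moved back by one period.\<close>

lemma nn_integral_ecis_shift:
  fixes h :: "complex \<Rightarrow> ennreal"
  assumes [measurable]: "h \<in> borel_measurable borel" and a: "0 \<le> a" "a \<le> 1"
  shows "(\<integral>\<^sup>+y. h (ecis (y + a)) \<partial>unif01) = (\<integral>\<^sup>+y. h (ecis y) \<partial>unif01)"
proof -
  define k where "k = (\<lambda>y. h (ecis y))"
  have [measurable]: "k \<in> borel_measurable borel" unfolding k_def by measurable
  have per: "k (y + 1) = k y" for y
    by (simp add: k_def distrib_left flip: cis_mult)
  have "(\<integral>\<^sup>+y. h (ecis (y + a)) \<partial>unif01) = (\<integral>\<^sup>+y. k (y + a) * indicator {a..1 + a} (y + a) \<partial>lborel)"
    unfolding k_def by (subst nn_integral_unif01) (auto simp: indicator_def intro!: nn_integral_cong)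
  also have "\<dots> = (\<integral>\<^sup>+y. k y * indicator {a..1 + a} y \<partial>lborel)"
    by (rule nn_integral_real_shift[where k = "\<lambda>y. k y * indicator {a..1 + a} y"]) measurable
  also have "\<dots> = (\<integral>\<^sup>+y. k y * indicator {a..1} y + k y * indicator {1<..1 + a} y \<partial>lborel)"
    using a by (intro nn_integral_cong) (auto simp: indicator_def)
  also have "\<dots> = (\<integral>\<^sup>+y. k y * indicator {a..1} y \<partial>lborel) + (\<integral>\<^sup>+y. k y * indicator {1<..1 + a} y \<partial>lborel)"
    by (rule nn_integral_add) auto
  also have "(\<integral>\<^sup>+y. k y * indicator {1<..1 + a} y \<partial>lborel) = (\<integral>\<^sup>+y. k (y + 1) * indicator {1<..1 + a} (y + 1) \<partial>lborel)"
    by (rule nn_integral_real_shift[where k = "\<lambda>y. k y * indicator {1<..1 + a} y", symmetric]) measurable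
  also have "\<dots> = (\<integral>\<^sup>+y. k y * indicator {0<..a} y \<partial>lborel)"
    unfolding per by (intro nn_integral_cong) (auto simp: indicator_def)
  also have "(\<integral>\<^sup>+y. k y * indicator {a..1} y \<partial>lborel) + (\<integral>\<^sup>+y. k y * indicator {0<..a} y \<partial>lborel)
      = (\<integral>\<^sup>+y. k y * indicator {a..1} y + k y * indicator {0<..a} y \<partial>lborel)"
    by (rule nn_integral_add[symmetric]) auto
  \<comment> \<open>The two pieces may overlap at a and miss 0, so the integrands agree only almost
    everywhere.\<close>
  also have "\<dots> = (\<integral>\<^sup>+y. k y * indicator {0..1} y \<partial>lborel)"
    using AE_lborel_singleton[of "0::real"] AE_lborel_singleton[of a]
    by (intro nn_integral_cong_AE, eventually_elim) (use a in \<open>auto simp: indicator_def\<close>)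
  also have "\<dots> = (\<integral>\<^sup>+y. h (ecis y) \<partial>unif01)"
    unfolding k_def by (subst nn_integral_unif01) auto
  finally show ?thesis .
qed

lemma unit_eq_ecis:
  assumes "cmod c = 1"
  obtains a where "0 \<le> a" "a \<le> 1" "c = ecis a"
proof (rule that[of "Arg2pi c / (2 * pi)"])
  show "0 \<le> Arg2pi c / (2 * pi)" "Arg2pi c / (2 * pi) \<le> 1"
    using Arg2pi_ge_0[of c] Arg2pi_lt_2pi[of c] by (auto simp: divide_simps)
  show "c = ecis (Arg2pi c / (2 * pi))"
    using Arg2pi_eq[of c] assms by (simp add: cis_conv_exp)
qed

lemma nn_integral_rotate:
  fixes h :: "complex \<Rightarrow> ennreal"
  assumes [measurable]: "h \<in> borel_measurable borel" and c: "cmod c = 1"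
  shows "(\<integral>\<^sup>+y. h (c * ecis y) \<partial>unif01) = (\<integral>\<^sup>+y. h (ecis y) \<partial>unif01)"
proof -
  obtain a where a: "0 \<le> a" "a \<le> 1" "c = ecis a" using unit_eq_ecis[OF c] .
  have "c * ecis y = ecis (y + a)" for y unfolding a(3) by (simp add: cis_mult algebra_simps)
  thus ?thesis using nn_integral_ecis_shift[OF assms(1) a(1,2)] by simp
qed

text \<open>For a fixed radius, a rotation merely shifts the uniform angle.\<close>

lemma radial_prob_radial_law:
  assumes [measurable]: "g \<in> borel_measurable borel"
  shows "radial_prob (radial_law g)"
  unfolding radial_prob_def rot_invariant_def
proof (intro conjI allI impI)
  show "sets (radial_law g) = sets borel" by (rule sets_radial_law)
  show "prob_space (radial_law g)" by (rule prob_space_radial_law) fact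
  fix c :: complex assume c: "cmod c = 1"
  show "distr (radial_law g) borel ((*) c) = radial_law g"
  proof (rule measure_eqI)
    fix A assume "A \<in> sets (distr (radial_law g) borel ((*) c))"
    hence [measurable]: "A \<in> sets borel" by simp
    have law: "(\<integral>\<^sup>+z. h z \<partial>radial_law g) = (\<integral>\<^sup>+x. \<integral>\<^sup>+y. h (of_real (g x) * ecis y) \<partial>unif01 \<partial>unif01)"
      if [measurable]: "h \<in> borel_measurable borel" for h
      unfolding radial_law_def
      by (subst nn_integral_distr) (auto simp: unif01.nn_integral_fst[symmetric] case_prod_unfold)
    have "emeasure (distr (radial_law g) borel ((*) c)) A = (\<integral>\<^sup>+z. indicator A z \<partial>distr (radial_law g) borel ((*) c))"
      by simp
    also have "\<dots> = (\<integral>\<^sup>+z. indicator A (c * z) \<partial>radial_law g)"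
      by (subst nn_integral_distr) auto
    also have "\<dots> = (\<integral>\<^sup>+x. \<integral>\<^sup>+y. indicator A (c * (of_real (g x) * ecis y)) \<partial>unif01 \<partial>unif01)"
      by (rule law) measurable
    also have "\<dots> = (\<integral>\<^sup>+x. \<integral>\<^sup>+y. indicator A (of_real (g x) * (c * ecis y)) \<partial>unif01 \<partial>unif01)"
      by (simp add: mult.left_commute)
    also have "\<dots> = (\<integral>\<^sup>+x. \<integral>\<^sup>+y. indicator A (of_real (g x) * ecis y) \<partial>unif01 \<partial>unif01)"
      using c by (intro nn_integral_cong nn_integral_rotate[where h = "\<lambda>w. indicator A (_ * w)"]) measurable
    also have "\<dots> = (\<integral>\<^sup>+z. indicator A z \<partial>radial_law g)"
      by (rule law[symmetric]) measurable
    also have "\<dots> = emeasure (radial_law g) A" by simp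
    finally show "emeasure (distr (radial_law g) borel ((*) c)) A = emeasure (radial_law g) A" .
  qed (simp add: sets_radial_law)
qed

text \<open>Averaging the invariance over a uniformly random rotation replaces each z by a uniform
  point of its circle. A rotation invariant measure is thus determined by the law of the
  modulus.\<close>

lemma emeasure_radial_prob:
  assumes \<mu>: "radial_prob \<mu>" and [measurable]: "A \<in> sets borel"
  shows "emeasure \<mu> A = (\<integral>\<^sup>+s. \<integral>\<^sup>+y. indicator A (of_real s * ecis y) \<partial>unif01 \<partial>distr \<mu> borel cmod)"
proof -
  have [measurable_cong]: "sets \<mu> = sets borel" and "prob_space \<mu>" and rot: "rot_invariant \<mu>"
    using \<mu> by (auto simp: radial_prob_def)
  interpret prob_space \<mu> by fact
  interpret P: pair_prob_space \<mu> unif01 by standard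
  have "emeasure \<mu> A = (\<integral>\<^sup>+y. emeasure \<mu> A \<partial>unif01)"
    by (simp add: unif01.emeasure_space_1[simplified])
  also have "\<dots> = (\<integral>\<^sup>+y. \<integral>\<^sup>+z. indicator A (ecis y * z) \<partial>\<mu> \<partial>unif01)"
  proof (rule nn_integral_cong)
    fix y
    have "distr \<mu> borel ((*) (ecis y)) = \<mu>" using rot by (simp add: rot_invariant_def)
    hence "emeasure \<mu> A = (\<integral>\<^sup>+z. indicator A z \<partial>distr \<mu> borel ((*) (ecis y)))" by simp
    also have "\<dots> = (\<integral>\<^sup>+z. indicator A (ecis y * z) \<partial>\<mu>)" by (subst nn_integral_distr) auto
    finally show "emeasure \<mu> A = (\<integral>\<^sup>+z. indicator A (ecis y * z) \<partial>\<mu>)" .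
  qed
  also have "\<dots> = (\<integral>\<^sup>+z. \<integral>\<^sup>+y. indicator A (ecis y * z) \<partial>unif01 \<partial>\<mu>)"
    by (rule P.Fubini') measurable
  also have "\<dots> = (\<integral>\<^sup>+z. \<integral>\<^sup>+y. indicator A (of_real (cmod z) * ecis y) \<partial>unif01 \<partial>\<mu>)"
  proof (rule nn_integral_cong)
    fix z
    obtain c where c: "cmod c = 1" "z = of_real (cmod z) * c"
      by (metis complex_mod_rcis norm_cis rcis_cmod_Arg rcis_def)
    have "(\<integral>\<^sup>+y. indicator A (ecis y * z) \<partial>unif01) = (\<integral>\<^sup>+y. indicator A (of_real (cmod z) * (c * ecis y)) \<partial>unif01)"
      by (subst c(2)) (simp add: mult_ac)
    also have "\<dots> = (\<integral>\<^sup>+y. indicator A (of_real (cmod z) * ecis y) \<partial>unif01)"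
      using c(1) by (intro nn_integral_rotate[where h = "\<lambda>w. indicator A (of_real (cmod z) * w)"]) measurable
    finally show "(\<integral>\<^sup>+y. indicator A (ecis y * z) \<partial>unif01) = (\<integral>\<^sup>+y. indicator A (of_real (cmod z) * ecis y) \<partial>unif01)" .
  qed
  also have "\<dots> = (\<integral>\<^sup>+s. \<integral>\<^sup>+y. indicator A (of_real s * ecis y) \<partial>unif01 \<partial>distr \<mu> borel cmod)"
    by (rule nn_integral_distr[symmetric]) measurable
  finally show ?thesis .
qed

text \<open>The uniqueness behind the definite descriptions. The family S covers both the open disks
  of \<open>sq\<close> and the closed disks of \<open>Rdiag_oplus\<close>. Masses of closed disks
  are recovered as decreasing limits of those of \<open>S (r + 1 / real (Suc n))\<close>, even at r
  = 0, so an atom at the origin is determined too.\<close>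

lemma radial_prob_eqI:
  assumes \<mu>1: "radial_prob \<mu>1" and \<mu>2: "radial_prob \<mu>2"
    and S: "\<And>r. ball 0 r \<subseteq> S r" "\<And>r. S r \<subseteq> cball 0 r" "\<And>r. S r \<in> sets borel"
    and eq: "\<And>r. r > 0 \<Longrightarrow> measure \<mu>1 (S r) = measure \<mu>2 (S r)"
  shows "\<mu>1 = \<mu>2"
proof -
  have cball: "(\<lambda>n. measure \<mu> (S (r + 1 / real (Suc n)))) \<longlonglongrightarrow> measure \<mu> (cball 0 r)"
    if \<mu>: "radial_prob \<mu>" for \<mu> and r :: real
  proof -
    interpret prob_space \<mu> using \<mu> by (simp add: radial_prob_def)
    have sets: "sets \<mu> = sets borel" using \<mu> by (simp add: radial_prob_def)
    have dec: "S r1 \<subseteq> S r2" if "r1 < r2" for r1 r2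
      using S(2)[of r1] S(1)[of r2] that by fastforce
    have "(\<lambda>n. measure \<mu> (S (r + 1 / real (Suc n)))) \<longlonglongrightarrow> measure \<mu> (\<Inter>n. S (r + 1 / real (Suc n)))"
    proof (rule finite_Lim_measure_decseq)
      show "range (\<lambda>n. S (r + 1 / real (Suc n))) \<subseteq> sets \<mu>" using S(3) sets by auto
      show "decseq (\<lambda>n. S (r + 1 / real (Suc n)))"
        by (intro decseq_SucI dec) (auto simp: field_simps)
    qed
    also have "(\<Inter>n. S (r + 1 / real (Suc n))) = cball 0 r"
    proof (intro equalityI subsetI)
      fix z :: complex assume z: "z \<in> cball 0 r"
      have "z \<in> S (r + 1 / real (Suc n))" for n
      proof (rule subsetD[OF S(1)])
        have "0 < 1 / real (Suc n)" by simp
        moreover have "cmod z \<le> r" using z by simp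
        ultimately have "cmod z < r + 1 / real (Suc n)" by linarith
        thus "z \<in> ball 0 (r + 1 / real (Suc n))" by (simp del: of_nat_Suc)
      qed
      thus "z \<in> (\<Inter>n. S (r + 1 / real (Suc n)))" by blast
    next
      fix z assume z: "z \<in> (\<Inter>n. S (r + 1 / real (Suc n)))"
      have "cmod z \<le> r + 1 / real (Suc n)" for n
        using z S(2)[of "r + 1 / real (Suc n)"] by (auto simp del: of_nat_Suc)
      moreover have "(\<lambda>n. r + 1 / real (Suc n)) \<longlonglongrightarrow> r" by real_asymp
      ultimately have "cmod z \<le> r" by (intro LIMSEQ_le_const) auto
      thus "z \<in> cball 0 r" by simp
    qed
    finally show ?thesis .
  qed
  have cdf_eq: "cdf (distr \<mu> borel cmod) r = measure \<mu> (cball 0 r)" if \<mu>: "radial_prob \<mu>" for \<mu> and r :: real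
  proof -
    have [measurable_cong]: "sets \<mu> = sets borel" using \<mu> by (simp add: radial_prob_def)
    have "space \<mu> = UNIV" using sets_eq_imp_space_eq[OF \<open>sets \<mu> = sets borel\<close>] by simp
    thus ?thesis unfolding cdf_def by (subst measure_distr) (auto intro!: arg_cong[where f="measure \<mu>"])
  qed
  have "measure \<mu>1 (cball 0 r) = measure \<mu>2 (cball 0 r)" for r
  proof (cases "r \<ge> 0")
    case True
    have "(\<lambda>n. measure \<mu>1 (S (r + 1 / real (Suc n)))) = (\<lambda>n. measure \<mu>2 (S (r + 1 / real (Suc n))))"
      using True by (intro ext eq add_nonneg_pos) auto
    thus ?thesis using cball[OF \<mu>1, of r] cball[OF \<mu>2, of r] LIMSEQ_unique by force
  qed auto
  hence "cdf (distr \<mu>1 borel cmod) = cdf (distr \<mu>2 borel cmod)"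
    using cdf_eq[OF \<mu>1] cdf_eq[OF \<mu>2] by auto
  moreover have rd: "real_distribution (distr \<mu> borel cmod)" if \<mu>: "radial_prob \<mu>" for \<mu>
  proof -
    have [measurable_cong]: "sets \<mu> = sets borel" using \<mu> by (simp add: radial_prob_def)
    interpret prob_space \<mu> using \<mu> by (simp add: radial_prob_def)
    show ?thesis by (rule real_distribution_distr) measurable
  qed
  ultimately have "distr \<mu>1 borel cmod = distr \<mu>2 borel cmod"
    by (intro cdf_unique rd \<mu>1 \<mu>2) auto
  thus ?thesis using \<mu>1 \<mu>2
    by (intro measure_eqI) (auto simp: radial_prob_def emeasure_radial_prob[OF \<mu>1] emeasure_radial_prob[OF \<mu>2])
qed

section \<open>Identification of the limit through the S-transform\<close>

lemma measure_radial_law: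
  assumes [measurable]: "g \<in> borel_measurable borel" "A \<in> sets borel" "T \<in> sets borel"
    and T: "\<And>z. z \<in> A \<longleftrightarrow> cmod z \<in> T"
  shows "measure (radial_law g) A = measure unif01 {x. \<bar>g x\<bar> \<in> T}"
proof -
  have "measure (radial_law g) A = measure unif01_sq ({x. \<bar>g x\<bar> \<in> T} \<times> UNIV)"
    unfolding radial_law_def
    by (subst measure_distr) (auto simp: T norm_mult space_pair_measure intro!: arg_cong[where f="measure unif01_sq"])
  also have "\<dots> = measure unif01 {x. \<bar>g x\<bar> \<in> T} * measure unif01 UNIV"
    by (subst measure_def, subst unif01.emeasure_pair_measure_Times) (auto simp: measure_def enn2real_mult)
  finally show ?thesis using unif01.prob_space by simp
qed

text \<open>For the point mass at 1, \<open>M_transform\<close> is \<open>y / (1 - y)\<close> with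
  inverse \<open>z / (1 + z)\<close>, so the S-transform is constantly 1 and only the prefactor
  remains.\<close>

lemma S_k_return_1:
  assumes k: "k > 1" and z: "-1 < z" "z < 0"
  shows "S_k (return borel 1) k z = (1 + z / k) / (k * (1 + z))"
proof -
  have "M_transform (return borel 1) y = y / (1 - y)" for y
    unfolding M_transform_def by (subst integral_return) auto
  moreover have zk: "-1 < z / k" "z / k < 0" using k z by (auto simp: field_simps)
  have "(THE y. y < 0 \<and> y / (1 - y) = z / k) = (z / k) / (1 + z / k)"
  proof (rule the_equality)
    define w where "w = z / k"
    have w: "-1 < w" "w < 0" using zk by (auto simp: w_def)
    have "1 - w / (1 + w) = 1 / (1 + w)" using w by (simp add: field_simps)
    hence "w / (1 + w) < 0 \<and> (w / (1 + w)) / (1 - w / (1 + w)) = w"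
      using w by (simp add: divide_neg_pos)
    thus "z / k / (1 + z / k) < 0 \<and> z / k / (1 + z / k) / (1 - z / k / (1 + z / k)) = z / k"
      unfolding w_def .
    fix y assume y: "y < 0 \<and> y / (1 - y) = z / k"
    hence "y = w * (1 - y)" by (simp add: w_def[symmetric] divide_eq_eq)
    hence "y * (1 + w) = w" by (simp add: algebra_simps)
    thus "y = z / k / (1 + z / k)" using w unfolding w_def[symmetric] by (simp add: eq_divide_eq)
  qed
  ultimately have "S_transform (return borel 1) (z / k) = 1"
    unfolding S_transform_def using k z zk by simp
  thus ?thesis unfolding S_k_def by simp
qed

context derivative_fraction
begin

text \<open>The equation for z is fractional linear, and its solution 1 + z = F is the inverse
  function of \<open>limit_radius t\<close> at \<open>r\<^sup>2\<close>. The threshold for r is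
  where F reaches 1, in agreement with the largest value
  \<open>limit_radius t 1 = 1 / (1 - t)\<close>.\<close>

lemma oplus_cdf_haar:
  assumes r: "r > 0"
  shows "oplus_cdf (return borel 1) 1 (1 / (1 - t)) r = measure unif01 {x. \<bar>sqrt (limit_radius t x)\<bar> \<in> {..r}}"
proof -
  define F where "F = r\<^sup>2 * t * (1 - t) / (1 - r\<^sup>2 * (1 - t)\<^sup>2)"
  have iff: "\<bar>sqrt (limit_radius t x)\<bar> \<le> r \<longleftrightarrow> limit_radius t x \<le> r\<^sup>2" if "x \<in> {0..1}" for x
    using limit_radius_bounds[OF that] r by (simp add: real_le_rsqrt sqrt_le_D real_sqrt_le_iff' real_le_lsqrt abs_of_nonneg)
  have msr: "measure unif01 {x. \<bar>sqrt (limit_radius t x)\<bar> \<in> {..r}} = measure lborel ({0..1} \<inter> {x. limit_radius t x \<le> r\<^sup>2})"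
  proof -
    have "{0..1} \<inter> {x. \<bar>sqrt (limit_radius t x)\<bar> \<in> {..r}} = {0..1} \<inter> {x. limit_radius t x \<le> r\<^sup>2}"
      using iff by auto
    thus ?thesis by (subst measure_uniform_measure) auto
  qed
  have rk: "r < sqrt (1 / (1 - t)) * 1 \<longleftrightarrow> r\<^sup>2 * (1 - t) < 1"
  proof -
    have "r < sqrt (1 / (1 - t)) \<longleftrightarrow> r\<^sup>2 < 1 / (1 - t)"
      using r t by (metis less_eq_real_def real_less_lsqrt real_less_rsqrt real_sqrt_less_iff real_sqrt_abs abs_of_pos)
    also have "\<dots> \<longleftrightarrow> r\<^sup>2 * (1 - t) < 1" using t by (simp add: less_divide_eq)
    finally show ?thesis by simp
  qed
  show ?thesis
  proof (cases "r\<^sup>2 * (1 - t) < 1")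
    case True
    have "r\<^sup>2 * (1 - t)\<^sup>2 = (r\<^sup>2 * (1 - t)) * (1 - t)" by (simp add: power2_eq_square)
    also have "\<dots> \<le> 1 * (1 - t)" using True t by (intro mult_right_mono) auto
    also have "1 * (1 - t) < 1" using t by simp
    finally have den: "1 - r\<^sup>2 * (1 - t)\<^sup>2 > 0" by simp
    have F0: "F > 0" unfolding F_def using den r t by (intro divide_pos_pos mult_pos_pos) auto
    have F1: "F < 1"
    proof -
      have "r\<^sup>2 * t * (1 - t) + r\<^sup>2 * (1 - t)\<^sup>2 = r\<^sup>2 * (1 - t)" by (simp add: power2_eq_square algebra_simps)
      hence "r\<^sup>2 * t * (1 - t) < 1 - r\<^sup>2 * (1 - t)\<^sup>2" using True by linarith
      thus ?thesis unfolding F_def using den by simp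
    qed
    have "{0..1} \<inter> {x. limit_radius t x \<le> r\<^sup>2} = {0..F}"
    proof -
      have "limit_radius t x \<le> r\<^sup>2 \<longleftrightarrow> x \<le> F" if "x \<in> {0..1}" for x
        using limit_radius_le_iff[OF that, of "r\<^sup>2"] den by (simp add: F_def pos_le_divide_eq)
      thus ?thesis using F1 by auto
    qed
    hence m: "measure unif01 {x. \<bar>sqrt (limit_radius t x)\<bar> \<in> {..r}} = F"
      unfolding msr using F0 by simp
    have Sk: "S_k (return borel 1) (1 / (1 - t)) z = 1 / r\<^sup>2 \<longleftrightarrow> z = F - 1" if z: "-1 < z" "z < 0" for z
    proof -
      have "S_k (return borel 1) (1 / (1 - t)) z = (1 + z * (1 - t)) * (1 - t) / (1 + z)"
        using t z by (subst S_k_return_1) (auto simp: field_simps)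
      also have "\<dots> = 1 / r\<^sup>2 \<longleftrightarrow> (1 + z * (1 - t)) * (1 - t) * r\<^sup>2 = 1 + z"
        using r z by (simp add: frac_eq_eq)
      \<comment> \<open>Write \<open>1 + z * (1 - t)\<close> as \<open>t + (1 - t) * (1 + z)\<close>
        and collect 1 + z.\<close>
      also have "\<dots> \<longleftrightarrow> (1 + z) * (1 - r\<^sup>2 * (1 - t)\<^sup>2) = r\<^sup>2 * t * (1 - t)"
        by (auto simp: power2_eq_square algebra_simps)
      also have "\<dots> \<longleftrightarrow> 1 + z = F" using den by (simp add: F_def eq_divide_eq)
      finally show ?thesis by auto
    qed
    have "(THE z. -1 < z \<and> z < 0 \<and> S_k (return borel 1) (1 / (1 - t)) z = 1 / r\<^sup>2) = F - 1"
      using Sk F0 F1 by (intro the_equality) auto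
    thus ?thesis unfolding oplus_cdf_def m using rk True by simp
  next
    case False
    have "limit_radius t x \<le> r\<^sup>2" if "x \<in> {0..1}" for x
    proof -
      have "limit_radius t x \<le> 1 / (1 - t)" using limit_radius_bounds[OF that] by simp
      also have "\<dots> \<le> r\<^sup>2" using False t by (simp add: divide_le_eq)
      finally show ?thesis .
    qed
    hence "{0..1} \<inter> {x. limit_radius t x \<le> r\<^sup>2} = {0..1}" by auto
    hence "measure unif01 {x. \<bar>sqrt (limit_radius t x)\<bar> \<in> {..r}} = 1" unfolding msr by simp
    thus ?thesis unfolding oplus_cdf_def using rk False by simp
  qed
qed

text \<open>The explicit law serves as the witness for the definite description; its square root is
  what \<open>sq\<close> undoes afterwards.\<close>

lemma haar_oplus_eq: "haar_oplus (1 / (1 - t)) = radial_law (\<lambda>x. sqrt (limit_radius t x))"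
proof -
  have lam: "sqrt (\<integral>x. x\<^sup>2 \<partial>return borel (1::real)) = 1"
    by (subst integral_return) auto
  have cd: "measure (radial_law (\<lambda>x. sqrt (limit_radius t x))) (cball 0 r)
     = oplus_cdf (return borel 1) 1 (1 / (1 - t)) r" if "r > 0" for r
    unfolding oplus_cdf_haar[OF that] by (rule measure_radial_law) (auto simp: dist_norm)
  show ?thesis unfolding haar_oplus_def Rdiag_oplus_def lam
  proof (rule the_equality)
    show "radial_prob (radial_law (\<lambda>x. sqrt (limit_radius t x))) \<and>
      (\<forall>r>0. measure (radial_law (\<lambda>x. sqrt (limit_radius t x))) (cball 0 r) = oplus_cdf (return borel 1) 1 (1 / (1 - t)) r)"
      using cd by (auto intro!: radial_prob_radial_law)
    fix \<mu> assume \<mu>: "radial_prob \<mu> \<and> (\<forall>r>0. measure \<mu> (cball 0 r) = oplus_cdf (return borel 1) 1 (1 / (1 - t)) r)"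
    show "\<mu> = radial_law (\<lambda>x. sqrt (limit_radius t x))"
      by (rule radial_prob_eqI[where S = "cball 0"]) (use \<mu> cd in \<open>auto intro!: radial_prob_radial_law\<close>)
  qed
qed

lemma sq_haar_oplus_eq: "sq (haar_oplus (1 / (1 - t))) = radial_law (limit_radius t)"
proof -
  have cd: "measure (radial_law (limit_radius t)) (ball 0 r)
     = measure (radial_law (\<lambda>x. sqrt (limit_radius t x))) (ball 0 (sqrt r))" if "r > 0" for r
  proof -
    have "measure (radial_law (limit_radius t)) (ball 0 r) = measure unif01 {x. \<bar>limit_radius t x\<bar> \<in> {..<r}}"
      by (rule measure_radial_law) (auto simp: dist_norm)
    also have "{x. \<bar>limit_radius t x\<bar> \<in> {..<r}} = {x. \<bar>sqrt (limit_radius t x)\<bar> \<in> {..<sqrt r}}"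
    proof -
      \<comment> \<open>The real square root is odd, so the two sets agree also at those x outside
        the unit interval where \<open>limit_radius t x\<close> is negative.\<close>
      have "\<bar>sqrt y\<bar> = sqrt \<bar>y\<bar>" for y by (cases "y \<ge> 0") (auto simp: real_sqrt_minus[symmetric] simp del: real_sqrt_minus)
      thus ?thesis by simp
    qed
    also have "measure unif01 \<dots> = measure (radial_law (\<lambda>x. sqrt (limit_radius t x))) (ball 0 (sqrt r))"
      by (rule measure_radial_law[symmetric]) (auto simp: dist_norm)
    finally show ?thesis .
  qed
  show ?thesis unfolding sq_def haar_oplus_eq
  proof (rule the_equality)
    show "radial_prob (radial_law (limit_radius t)) \<and> (\<forall>r>0. measure (radial_law (limit_radius t)) (ball 0 r)
       = measure (radial_law (\<lambda>x. sqrt (limit_radius t x))) (ball 0 (sqrt r)))"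
      using cd by (auto intro!: radial_prob_radial_law)
    fix \<mu> assume \<mu>: "radial_prob \<mu> \<and> (\<forall>r>0. measure \<mu> (ball 0 r)
       = measure (radial_law (\<lambda>x. sqrt (limit_radius t x))) (ball 0 (sqrt r)))"
    show "\<mu> = radial_law (limit_radius t)"
      by (rule radial_prob_eqI[where S = "ball 0"]) (use \<mu> cd in \<open>auto intro!: radial_prob_radial_law\<close>)
  qed
qed

end

theorem theorem1p2:
  fixes M :: "'a measure" and \<xi> :: "nat \<Rightarrow> 'a \<Rightarrow> complex" and t :: real
  assumes "prob_space M"
    and "prob_space.indep_vars M (\<lambda>_. borel) \<xi> UNIV"
    and "\<And>k. distr M borel (\<xi> k) = std_complex_gaussian"
    and "0 < t" and "t < 1"
  shows "weak_conv_in_prob M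
           (\<lambda>n \<omega>. empirical_root_measure
                   ((pderiv ^^ nat \<lceil>t * real n\<rceil>) (pcompose (rand_poly \<xi> n \<omega>) [:0, (1 - t)\<^sup>2:])))
           (sq (haar_oplus (1 / (1 - t))))"
proof -
  interpret prob_space M by fact
  interpret random_derivative M \<xi> t
    by unfold_locales (use assms in auto)
  show ?thesis
    unfolding sq_haar_oplus_eq using weak_conv_dpoly by (simp add: dpoly_def)
qed

end
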